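(* Let $A$ be an algebra in a congruence-modular variety $\mathbf V$. Then: (1) If $\mathcal U,\mathcal V\in\operatorname{Unif}A$, then $[\mathcal U,\mathcal V]=[\mathcal V,\mathcal U]$. (2) The commutator is monotone: if $\mathcal U,\mathcal U',\mathcal V\in\operatorname{Unif}A$ and $\mathcal U\le\mathcal U'$, then $[\mathcal U,\mathcal V]\le[\mathcal U',\mathcal V]$. (3) For $\mathcal U,\mathcal V\in\operatorname{Unif}A$, $[\mathcal U,\mathcal V]\le\mathcal U\wedge\mathcal V$. (4) If $B\in\mathbf V$, $f:B\to A$ is a homomorphism, and $\mathcal U,\mathcal V\in\operatorname{Unif}A$, then $[f^{-1}(\mathcal U),f^{-1}(\mathcal V)]\le f^{-1}([\mathcal U,\mathcal V])$.
   Context: Algebras have finitary operations (the underlying set may be empty). A uniformity on a set $S$ is a filter $\mathcal U$ of binary relations on $S$ such that every $U\in\mathcal U$ is reflexive, $U\in\mathcal U$ implies $U^{-1}\in\mathcal U$, and for each $U\in\mathcal U$ there is $V\in\mathcal U$ with $V\circ V\subseteq U$. A uniformity $\mathcal U$ on an algebra $A$ is compatible if for each basic operation $\omega$ and $U\in\mathcal U$ there is $\bar U\in\mathcal U$ such that $x_i\mathrel{\bar U}y_i$ for all $i$ implies $\omega(\mathbf x)\mathrel U\omega(\mathbf y)$. $\operatorname{Unif}A$ is the complete lattice of compatible uniformities on $A$, ordered by reverse inclusion ($\mathcal U\le\mathcal V$ iff $\mathcal V\subseteq\mathcal U$). For a homomorphism $f:B\to A$ and $\mathcal U\in\operatorname{Unif}A$,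 $f^{-1}(\mathcal U)\in\operatorname{Unif}B$ is the filter generated by the relations $f^{-1}(U)=\{\langle b,b'\rangle: f(b)\mathrel Uf(b')\}$, $U\in\mathcal U$. For binary relations $U,V$ on $A$, $n,n'\ge0$ and an $(n+n')$-ary term $t$, $\mathrm M_{n,n',t}(U,V)$ is the set of matrices $\begin{pmatrix}t(\mathbf a,\mathbf b)&t(\mathbf a,\mathbf c)\\t(\mathbf a',\mathbf b)&t(\mathbf a',\mathbf c)\end{pmatrix}$ with $\mathbf a,\mathbf a'\in A^n$, $\mathbf b,\mathbf c\in A^{n'}$, $a_i\mathrel Ua'_i$ and $b_j\mathrel Vc_j$ for all $i,j$. The commutator $[\mathcal U,\mathcal V]$ of $\mathcal U,\mathcal V\in\operatorname{Unif}A$ ($A$ in a congruence-modular variety) is the least $\mathcal W\in\operatorname{Unif}A$ such that for all $n,n',t$ and all $W\in\mathcal W$ there are $U\in\mathcal U$, $V\in\mathcal V$, $\bar W\in\mathcal W$ such that $(u_{ij})\in\mathrm M_{n,n',t}(U,V)$ and $u_{11}\mathrel{\bar W}u_{12}$ imply $u_{21}\mathrel Wu_{22}$. *)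

theory Defs
  imports "HOL-Algebra.Lattice" "HOL-Library.FuncSet"
begin

section \<open>Algebras, terms and varieties\<close>

text \<open>A signature is a partial map from symbols to arities; its domain is the set of basic
  operation symbols (possibly empty, and possibly with nullary symbols).  Tuples are lists.
  Carriers may be empty.\<close>

type_synonym 'f signature = "'f \<Rightarrow> nat option"

record ('f, 'a) algebra = "'a partial_object" +
  oper :: "'f \<Rightarrow> 'a list \<Rightarrow> 'a"

definition is_algebra :: "'f signature \<Rightarrow> ('f, 'a) algebra \<Rightarrow> bool" where
  "is_algebra \<Sigma> A \<longleftrightarrow>
    (\<forall>g n xs. \<Sigma> g = Some n \<and> length xs = n \<and> set xs \<subseteq> carrier A \<longrightarrow> oper A g xs \<in> carrier A)"

definition is_hom :: "'f signature \<Rightarrow> ('f, 'b) algebra \<Rightarrow> ('f, 'a) algebra \<Rightarrow> ('b \<Rightarrow> 'a) \<Rightarrow> bool" where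
  "is_hom \<Sigma> B A h \<longleftrightarrow> h \<in> carrier B \<rightarrow> carrier A \<and>
    (\<forall>g n xs. \<Sigma> g = Some n \<and> length xs = n \<and> set xs \<subseteq> carrier B \<longrightarrow>
      h (oper B g xs) = oper A g (map h xs))"

datatype (syms_trm: 'f, vars_trm: 'v) trm = Var 'v | App 'f "('f, 'v) trm list"

fun wf_trm :: "'f signature \<Rightarrow> ('f, 'v) trm \<Rightarrow> bool" where
  "wf_trm \<Sigma> (Var v) \<longleftrightarrow> True"
| "wf_trm \<Sigma> (App g ts) \<longleftrightarrow> \<Sigma> g = Some (length ts) \<and> (\<forall>t\<in>set ts. wf_trm \<Sigma> t)"

fun trm_val :: "('f, 'a) algebra \<Rightarrow> ('v \<Rightarrow> 'a) \<Rightarrow> ('f, 'v) trm \<Rightarrow> 'a" where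
  "trm_val A \<rho> (Var v) = \<rho> v"
| "trm_val A \<rho> (App g ts) = oper A g (map (trm_val A \<rho>) ts)"

text \<open>A variety is given by a signature and a set of identities over countably many variables;
  its members, on any carrier type, are the algebras satisfying these identities.\<close>

type_synonym 'f identities = "(('f, nat) trm \<times> ('f, nat) trm) set"

definition wf_identities :: "'f signature \<Rightarrow> 'f identities \<Rightarrow> bool" where
  "wf_identities \<Sigma> E \<longleftrightarrow> (\<forall>(s, t)\<in>E. wf_trm \<Sigma> s \<and> wf_trm \<Sigma> t)"

definition in_variety :: "'f signature \<Rightarrow> 'f identities \<Rightarrow> ('f, 'a) algebra \<Rightarrow> bool" where
  "in_variety \<Sigma> E A \<longleftrightarrow> is_algebra \<Sigma> A \<and>
    (\<forall>(s, t)\<in>E. \<forall>\<rho>. range \<rho> \<subseteq> carrier A \<longrightarrow> trm_val A \<rho> s = trm_val A \<rho> t)"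


section \<open>Congruence modularity\<close>

definition is_congruence :: "'f signature \<Rightarrow> ('f, 'a) algebra \<Rightarrow> ('a \<times> 'a) set \<Rightarrow> bool" where
  "is_congruence \<Sigma> A \<theta> \<longleftrightarrow> equiv (carrier A) \<theta> \<and>
    (\<forall>g n xs ys. \<Sigma> g = Some n \<and> length xs = n \<and> length ys = n \<and>
      list_all2 (\<lambda>x y. (x, y) \<in> \<theta>) xs ys \<longrightarrow> (oper A g xs, oper A g ys) \<in> \<theta>)"

definition Con :: "'f signature \<Rightarrow> ('f, 'a) algebra \<Rightarrow> ('a \<times> 'a) set gorder" where
  "Con \<Sigma> A = \<lparr>carrier = {\<theta>. is_congruence \<Sigma> A \<theta>}, eq = (=), le = (\<subseteq>)\<rparr>"

definition modular_lattice :: "('c, 'd) gorder_scheme \<Rightarrow> bool" where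
  "modular_lattice L \<longleftrightarrow> lattice L \<and>
    (\<forall>x\<in>carrier L. \<forall>y\<in>carrier L. \<forall>z\<in>carrier L.
      x \<sqsubseteq>\<^bsub>L\<^esub> z \<longrightarrow> x \<squnion>\<^bsub>L\<^esub> (y \<sqinter>\<^bsub>L\<^esub> z) = (x \<squnion>\<^bsub>L\<^esub> y) \<sqinter>\<^bsub>L\<^esub> z)"

text \<open>HOL cannot quantify over the carrier types of the members of a variety inside a formula, so
  members are taken on one fixed type. Nothing is lost: a failure of the modular law in an algebra
  on any type is witnessed by finitely many elements, hence occurs already in a finitely generated
  subalgebra, which is a quotient of a term algebra and so has an isomorphic copy whose elements
  are equivalence classes of terms.\<close>

definition congruence_modular :: "'f signature \<Rightarrow> 'f identities \<Rightarrow> bool" where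
  "congruence_modular \<Sigma> E \<longleftrightarrow>
    (\<forall>C :: ('f, ('f, nat) trm set) algebra. in_variety \<Sigma> E C \<longrightarrow> modular_lattice (Con \<Sigma> C))"


section \<open>Compatible uniformities\<close>

text \<open>Filters are not required to be proper: on the empty set the only uniformity is
  \<open>{{}}\<close>, and on a nonempty set reflexivity already excludes the empty relation.\<close>

definition is_filter_on :: "'c set \<Rightarrow> 'c set set \<Rightarrow> bool" where
  "is_filter_on X F \<longleftrightarrow> F \<subseteq> Pow X \<and> X \<in> F \<and>
    (\<forall>P\<in>F. \<forall>Q. P \<subseteq> Q \<and> Q \<subseteq> X \<longrightarrow> Q \<in> F) \<and> (\<forall>P\<in>F. \<forall>Q\<in>F. P \<inter> Q \<in> F)"

definition generated_filter :: "'c set \<Rightarrow> 'c set set \<Rightarrow> 'c set set" where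
  "generated_filter X G = \<Inter>{F. is_filter_on X F \<and> G \<subseteq> F}"

definition is_uniformity :: "'a set \<Rightarrow> ('a \<times> 'a) set set \<Rightarrow> bool" where
  "is_uniformity S \<U> \<longleftrightarrow> is_filter_on (S \<times> S) \<U> \<and>
    (\<forall>U\<in>\<U>. refl_on S U) \<and> (\<forall>U\<in>\<U>. U\<inverse> \<in> \<U>) \<and> (\<forall>U\<in>\<U>. \<exists>V\<in>\<U>. V O V \<subseteq> U)"

definition compatible :: "'f signature \<Rightarrow> ('f, 'a) algebra \<Rightarrow> ('a \<times> 'a) set set \<Rightarrow> bool" where
  "compatible \<Sigma> A \<U> \<longleftrightarrow>
    (\<forall>g n. \<Sigma> g = Some n \<longrightarrow> (\<forall>U\<in>\<U>. \<exists>U'\<in>\<U>. \<forall>xs ys.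
      length xs = n \<and> length ys = n \<and> list_all2 (\<lambda>x y. (x, y) \<in> U') xs ys \<longrightarrow>
        (oper A g xs, oper A g ys) \<in> U))"

text \<open>The order is reverse inclusion.\<close>

definition Unif :: "'f signature \<Rightarrow> ('f, 'a) algebra \<Rightarrow> ('a \<times> 'a) set set gorder" where
  "Unif \<Sigma> A = \<lparr>carrier = {\<U>. is_uniformity (carrier A) \<U> \<and> compatible \<Sigma> A \<U>},
    eq = (=), le = (\<lambda>\<U> \<V>. \<V> \<subseteq> \<U>)\<rparr>"

definition inverse_image_rel :: "'b set \<Rightarrow> ('b \<Rightarrow> 'a) \<Rightarrow> ('a \<times> 'a) set \<Rightarrow> ('b \<times> 'b) set" where
  "inverse_image_rel T h U = {(b, b') \<in> T \<times> T. (h b, h b') \<in> U}"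

definition inverse_image_unif ::
    "('f, 'b) algebra \<Rightarrow> ('b \<Rightarrow> 'a) \<Rightarrow> ('a \<times> 'a) set set \<Rightarrow> ('b \<times> 'b) set set" where
  "inverse_image_unif B h \<U> =
    generated_filter (carrier B \<times> carrier B) (inverse_image_rel (carrier B) h ` \<U>)"


section \<open>The commutator\<close>

text \<open>The matrix with rows \<open>u11, u12\<close> and \<open>u21, u22\<close> is the tuple \<open>(u11, u12, u21, u22)\<close>.
  An \<open>m\<close>-ary term is a term in the variables \<open>0, \<dots>, m - 1\<close>; here variable \<open>i < n\<close> gets the value
  \<open>a\<^sub>i\<close> and variable \<open>n + j\<close> gets \<open>b\<^sub>j\<close>.\<close>

definition matrices ::
    "('f, 'a) algebra \<Rightarrow> nat \<Rightarrow> nat \<Rightarrow> ('f, nat) trm \<Rightarrow> ('a \<times> 'a) set \<Rightarrow> ('a \<times> 'a) set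
      \<Rightarrow> ('a \<times> 'a \<times> 'a \<times> 'a) set" where
  "matrices A n n' t U V =
    {(trm_val A ((!) (a @ b)) t, trm_val A ((!) (a @ c)) t,
      trm_val A ((!) (a' @ b)) t, trm_val A ((!) (a' @ c)) t) | a a' b c.
      length a = n \<and> length a' = n \<and> length b = n' \<and> length c = n' \<and>
      set a \<subseteq> carrier A \<and> set a' \<subseteq> carrier A \<and> set b \<subseteq> carrier A \<and> set c \<subseteq> carrier A \<and>
      list_all2 (\<lambda>x y. (x, y) \<in> U) a a' \<and> list_all2 (\<lambda>x y. (x, y) \<in> V) b c}"

definition term_condition ::
    "'f signature \<Rightarrow> ('f, 'a) algebra \<Rightarrow> ('a \<times> 'a) set set \<Rightarrow> ('a \<times> 'a) set set
      \<Rightarrow> ('a \<times> 'a) set set \<Rightarrow> bool" where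
  "term_condition \<Sigma> A \<U> \<V> \<W> \<longleftrightarrow>
    (\<forall>n n' t. wf_trm \<Sigma> t \<and> vars_trm t \<subseteq> {..<n + n'} \<longrightarrow>
      (\<forall>W\<in>\<W>. \<exists>U\<in>\<U>. \<exists>V\<in>\<V>. \<exists>W'\<in>\<W>. \<forall>u11 u12 u21 u22.
        (u11, u12, u21, u22) \<in> matrices A n n' t U V \<and> (u11, u12) \<in> W' \<longrightarrow> (u21, u22) \<in> W))"

definition commutator ::
    "'f signature \<Rightarrow> ('f, 'a) algebra \<Rightarrow> ('a \<times> 'a) set set \<Rightarrow> ('a \<times> 'a) set set
      \<Rightarrow> ('a \<times> 'a) set set" where
  "commutator \<Sigma> A \<U> \<V> =
    (THE \<W>. least (Unif \<Sigma> A) \<W> {\<W> \<in> carrier (Unif \<Sigma> A). term_condition \<Sigma> A \<U> \<V> \<W>})"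


text \<open>The least such uniformity exists (in any variety): it is the meet of all of them.\<close>

lemma is_filter_on_generated_filter:
  assumes "G \<subseteq> Pow X"
  shows "is_filter_on X (generated_filter X G)"
proof -
  let ?\<F> = "{F. is_filter_on X F \<and> G \<subseteq> F}"
  have F: "X \<in> F" "P \<in> F \<Longrightarrow> P \<subseteq> Q \<Longrightarrow> Q \<subseteq> X \<Longrightarrow> Q \<in> F"
    "P \<in> F \<Longrightarrow> Q \<in> F \<Longrightarrow> P \<inter> Q \<in> F" if "F \<in> ?\<F>" for F P Q
    using that by (auto simp: is_filter_on_def)
  have "Pow X \<in> ?\<F>"
    using assms by (auto simp: is_filter_on_def)
  then have "\<Inter>?\<F> \<subseteq> Pow X"
    by (rule Inter_lower)
  moreover have "X \<in> \<Inter>?\<F>"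
    by (rule InterI) (rule F)
  moreover have "Q \<in> \<Inter>?\<F>" if "P \<in> \<Inter>?\<F>" "P \<subseteq> Q \<and> Q \<subseteq> X" for P Q
    by (rule InterI, rule F(2)) (use that in \<open>auto dest: InterD\<close>)
  moreover have "P \<inter> Q \<in> \<Inter>?\<F>" if "P \<in> \<Inter>?\<F>" "Q \<in> \<Inter>?\<F>" for P Q
    by (rule InterI, rule F(3)) (use that in \<open>auto dest: InterD\<close>)
  ultimately show ?thesis
    unfolding generated_filter_def is_filter_on_def[of X "\<Inter>?\<F>"] by (intro conjI ballI allI impI)
qed

lemma generated_filter_induct:
  assumes "P \<in> generated_filter X G" and "G \<subseteq> Pow X"
    and base: "\<And>P. P \<in> G \<Longrightarrow> \<phi> P" and top: "\<phi> X"
    and up: "\<And>P Q. \<phi> P \<Longrightarrow> P \<subseteq> Q \<Longrightarrow> Q \<subseteq> X \<Longrightarrow> \<phi> Q"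
    and int: "\<And>P Q. \<phi> P \<Longrightarrow> \<phi> Q \<Longrightarrow> \<phi> (P \<inter> Q)"
  shows "\<phi> P"
proof -
  have "is_filter_on X {P. P \<subseteq> X \<and> \<phi> P}"
    unfolding is_filter_on_def using top up int by blast
  moreover have "G \<subseteq> {P. P \<subseteq> X \<and> \<phi> P}"
    using assms(2) base by blast
  ultimately show ?thesis
    using assms(1) unfolding generated_filter_def by blast
qed

lemma matrices_mono:
  assumes "U \<subseteq> U'" and "V \<subseteq> V'"
  shows "matrices A n n' t U V \<subseteq> matrices A n n' t U' V'"
proof
  fix m assume "m \<in> matrices A n n' t U V"
  then obtain a a' b c where
    m: "m = (trm_val A ((!) (a @ b)) t, trm_val A ((!) (a @ c)) t,
      trm_val A ((!) (a' @ b)) t, trm_val A ((!) (a' @ c)) t)"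
    and len: "length a = n" "length a' = n" "length b = n'" "length c = n'"
    and carr: "set a \<subseteq> carrier A" "set a' \<subseteq> carrier A" "set b \<subseteq> carrier A" "set c \<subseteq> carrier A"
    and rel: "list_all2 (\<lambda>x y. (x, y) \<in> U) a a'" "list_all2 (\<lambda>x y. (x, y) \<in> V) b c"
    unfolding matrices_def mem_Collect_eq by (elim exE conjE)
  have "list_all2 (\<lambda>x y. (x, y) \<in> U') a a'"
    by (rule list_all2_mono[OF rel(1)]) (use assms in blast)
  moreover have "list_all2 (\<lambda>x y. (x, y) \<in> V') b c"
    by (rule list_all2_mono[OF rel(2)]) (use assms in blast)
  ultimately show "m \<in> matrices A n n' t U' V'"
    unfolding matrices_def mem_Collect_eq
    by (intro exI[of _ a] exI[of _ a'] exI[of _ b] exI[of _ c] conjI m len carr)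
qed

lemma least_commutator:
  fixes A :: "('f, 'a) algebra"
  assumes A: "is_algebra \<Sigma> A" and \<U>: "\<U> \<in> carrier (Unif \<Sigma> A)" and \<V>: "\<V> \<in> carrier (Unif \<Sigma> A)"
  shows "least (Unif \<Sigma> A) (commutator \<Sigma> A \<U> \<V>)
    {\<W> \<in> carrier (Unif \<Sigma> A). term_condition \<Sigma> A \<U> \<V> \<W>}"
proof -
  define S where "S = carrier A"
  define K where "K = {\<W> \<in> carrier (Unif \<Sigma> A). term_condition \<Sigma> A \<U> \<V> \<W>}"
  define L where "L = generated_filter (S \<times> S) (\<Union>K)"
  have KD: "is_uniformity S \<W>" "compatible \<Sigma> A \<W>" "term_condition \<Sigma> A \<U> \<V> \<W>" if "\<W> \<in> K" for \<W>
    using that by (auto simp: K_def Unif_def S_def)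
  have KP: "\<Union>K \<subseteq> Pow (S \<times> S)"
  proof (rule Union_least)
    show "\<W> \<subseteq> Pow (S \<times> S)" if "\<W> \<in> K" for \<W>
      using KD(1)[OF that] by (simp add: is_uniformity_def is_filter_on_def)
  qed
  have LF: "is_filter_on (S \<times> S) L"
    unfolding L_def by (rule is_filter_on_generated_filter[OF KP])
  then have Ltop: "S \<times> S \<in> L" and Lint: "\<And>P Q. P \<in> L \<Longrightarrow> Q \<in> L \<Longrightarrow> P \<inter> Q \<in> L"
    and Lup: "\<And>P Q. P \<in> L \<Longrightarrow> P \<subseteq> Q \<Longrightarrow> Q \<subseteq> S \<times> S \<Longrightarrow> Q \<in> L" and LP: "L \<subseteq> Pow (S \<times> S)"
    unfolding is_filter_on_def by simp_all
  have KL: "\<W> \<subseteq> L" if "\<W> \<in> K" for \<W>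
    using that unfolding L_def generated_filter_def by blast
  note ind = generated_filter_induct[OF _ KP, folded L_def]
  have UV: "is_filter_on (S \<times> S) \<U>" "is_filter_on (S \<times> S) \<V>"
    using \<U> \<V> by (auto simp: Unif_def is_uniformity_def S_def)
  have refl: "refl_on S W" if "W \<in> L" for W
    using that by (rule ind)
      (use KD(1) in \<open>auto simp: is_uniformity_def refl_on_def\<close>)
  have sym: "W\<inverse> \<in> L" if "W \<in> L" for W
    using that
  proof (rule ind)
    show "P\<inverse> \<in> L" if "P \<in> \<Union>K" for P
    proof -
      from that obtain \<W> where W: "\<W> \<in> K" "P \<in> \<W>" by blast
      then have "P\<inverse> \<in> \<W>" using KD(1)[OF W(1)] by (simp add: is_uniformity_def)
      with KL[OF W(1)] show ?thesis ..
    qed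
    show "Q\<inverse> \<in> L" if "P\<inverse> \<in> L" "P \<subseteq> Q" "Q \<subseteq> S \<times> S" for P Q
      using that by (intro Lup[OF that(1)]) auto
  qed (use Ltop Lint in \<open>simp_all add: converse_Times converse_Int\<close>)
  have comp: "\<exists>V\<in>L. V O V \<subseteq> W" if "W \<in> L" for W
    using that
  proof (rule ind)
    show "\<exists>V\<in>L. V O V \<subseteq> P" if "P \<in> \<Union>K" for P
    proof -
      from that obtain \<W> where W: "\<W> \<in> K" "P \<in> \<W>" by blast
      then have "\<exists>V\<in>\<W>. V O V \<subseteq> P" using KD(1)[OF W(1)] by (simp add: is_uniformity_def)
      with KL[OF W(1)] show ?thesis by blast
    qed
    show "\<exists>V\<in>L. V O V \<subseteq> S \<times> S"
      by (intro bexI[OF _ Ltop]) auto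
    show "\<exists>V\<in>L. V O V \<subseteq> P \<inter> Q" if "\<exists>V\<in>L. V O V \<subseteq> P" "\<exists>V\<in>L. V O V \<subseteq> Q" for P Q
    proof -
      from that obtain V V' where "V \<in> L" "V O V \<subseteq> P" "V' \<in> L" "V' O V' \<subseteq> Q" by blast
      then have "V \<inter> V' \<in> L" "(V \<inter> V') O (V \<inter> V') \<subseteq> P \<inter> Q" using Lint by auto
      then show ?thesis by blast
    qed
  qed (meson order_trans)
  have compat: "\<exists>U'\<in>L. \<forall>xs ys. length xs = n \<and> length ys = n \<and>
      list_all2 (\<lambda>x y. (x, y) \<in> U') xs ys \<longrightarrow> (oper A g xs, oper A g ys) \<in> W"
    if "W \<in> L" and g: "\<Sigma> g = Some n" for W g n
    using that(1)
  proof (rule ind)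
    show "\<exists>U'\<in>L. \<forall>xs ys. length xs = n \<and> length ys = n \<and>
      list_all2 (\<lambda>x y. (x, y) \<in> U') xs ys \<longrightarrow> (oper A g xs, oper A g ys) \<in> P" if "P \<in> \<Union>K" for P
    proof -
      from that obtain \<W> where W: "\<W> \<in> K" "P \<in> \<W>" by blast
      with KD(2)[OF W(1)] g KL[OF W(1)] show ?thesis
        unfolding compatible_def by (meson subsetD)
    qed
    show "\<exists>U'\<in>L. \<forall>xs ys. length xs = n \<and> length ys = n \<and>
      list_all2 (\<lambda>x y. (x, y) \<in> U') xs ys \<longrightarrow> (oper A g xs, oper A g ys) \<in> S \<times> S"
    proof (intro bexI[OF _ Ltop] allI impI)
      fix xs ys
      assume *: "length xs = n \<and> length ys = n \<and> list_all2 (\<lambda>x y. (x, y) \<in> S \<times> S) xs ys"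
      then have "list_all2 (\<lambda>x y. (x, y) \<in> S \<times> S) xs ys" by blast
      then have "set xs \<subseteq> S \<and> set ys \<subseteq> S"
        by (induction rule: list_all2_induct) auto
      with * A g show "(oper A g xs, oper A g ys) \<in> S \<times> S"
        by (simp add: is_algebra_def S_def)
    qed
    show "\<exists>U'\<in>L. \<forall>xs ys. length xs = n \<and> length ys = n \<and>
      list_all2 (\<lambda>x y. (x, y) \<in> U') xs ys \<longrightarrow> (oper A g xs, oper A g ys) \<in> P \<inter> Q"
      if P: "\<exists>U'\<in>L. \<forall>xs ys. length xs = n \<and> length ys = n \<and>
        list_all2 (\<lambda>x y. (x, y) \<in> U') xs ys \<longrightarrow> (oper A g xs, oper A g ys) \<in> P"
      and Q: "\<exists>U'\<in>L. \<forall>xs ys. length xs = n \<and> length ys = n \<and>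
        list_all2 (\<lambda>x y. (x, y) \<in> U') xs ys \<longrightarrow> (oper A g xs, oper A g ys) \<in> Q" for P Q
    proof -
      from P obtain U1 where U1: "U1 \<in> L" "\<And>xs ys. length xs = n \<and> length ys = n \<and>
        list_all2 (\<lambda>x y. (x, y) \<in> U1) xs ys \<Longrightarrow> (oper A g xs, oper A g ys) \<in> P" by blast
      from Q obtain U2 where U2: "U2 \<in> L" "\<And>xs ys. length xs = n \<and> length ys = n \<and>
        list_all2 (\<lambda>x y. (x, y) \<in> U2) xs ys \<Longrightarrow> (oper A g xs, oper A g ys) \<in> Q" by blast
      show ?thesis
      proof (intro bexI[OF _ Lint[OF U1(1) U2(1)]] allI impI)
        fix xs ys
        assume *: "length xs = n \<and> length ys = n \<and> list_all2 (\<lambda>x y. (x, y) \<in> U1 \<inter> U2) xs ys"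
        then have "list_all2 (\<lambda>x y. (x, y) \<in> U1 \<inter> U2) xs ys" by blast
        then have "list_all2 (\<lambda>x y. (x, y) \<in> U1) xs ys" "list_all2 (\<lambda>x y. (x, y) \<in> U2) xs ys"
          by (auto elim!: list_all2_mono)
        with * U1(2) U2(2) show "(oper A g xs, oper A g ys) \<in> P \<inter> Q" by blast
      qed
    qed
  qed (meson subsetD)
  have tc: "\<exists>U\<in>\<U>. \<exists>V\<in>\<V>. \<exists>W'\<in>L. \<forall>u11 u12 u21 u22.
      (u11, u12, u21, u22) \<in> matrices A n n' t U V \<and> (u11, u12) \<in> W' \<longrightarrow> (u21, u22) \<in> W"
    if "W \<in> L" and t: "wf_trm \<Sigma> t \<and> vars_trm t \<subseteq> {..<n + n'}" for W n n' t
  proof -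
    have val: "trm_val A \<rho> s \<in> S" if "wf_trm \<Sigma> s" "\<rho> ` vars_trm s \<subseteq> S" for \<rho> and s :: "('f, nat) trm"
      using that
    proof (induction s)
      case (App g ts)
      then have "set (map (trm_val A \<rho>) ts) \<subseteq> S" by fastforce
      with App.prems A show ?case
        unfolding is_algebra_def S_def by (metis length_map trm_val.simps(2) wf_trm.simps(2))
    qed auto
    have top: "u21 \<in> S \<and> u22 \<in> S" if "(u11, u12, u21, u22) \<in> matrices A n n' t U V" for u11 u12 u21 u22 U V
    proof -
      from that obtain a b c where
        "length a = n" "length b = n'" "length c = n'" "set a \<subseteq> S" "set b \<subseteq> S" "set c \<subseteq> S"
        "u21 = trm_val A ((!) (a @ b)) t" "u22 = trm_val A ((!) (a @ c)) t"
        unfolding matrices_def S_def by blast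
      moreover have "(!) xs ` vars_trm t \<subseteq> S" if "length xs = n + n'" "set xs \<subseteq> S" for xs
        using that t by (auto simp: subset_iff)
      ultimately show ?thesis using t by (simp add: val)
    qed
    show ?thesis using \<open>W \<in> L\<close>
    proof (rule ind)
      show "\<exists>U\<in>\<U>. \<exists>V\<in>\<V>. \<exists>W'\<in>L. \<forall>u11 u12 u21 u22.
        (u11, u12, u21, u22) \<in> matrices A n n' t U V \<and> (u11, u12) \<in> W' \<longrightarrow> (u21, u22) \<in> P"
        if P: "P \<in> \<Union>K" for P
      proof -
        from P obtain \<W> where W: "\<W> \<in> K" "P \<in> \<W>" by blast
        from KD(3)[OF W(1)] W(2) t obtain U V W' where
          "U \<in> \<U>" "V \<in> \<V>" "W' \<in> \<W>" "\<forall>u11 u12 u21 u22.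
           (u11, u12, u21, u22) \<in> matrices A n n' t U V \<and> (u11, u12) \<in> W' \<longrightarrow> (u21, u22) \<in> P"
          unfolding term_condition_def by blast
        then show ?thesis using KL[OF W(1)] by blast
      qed
      show "\<exists>U\<in>\<U>. \<exists>V\<in>\<V>. \<exists>W'\<in>L. \<forall>u11 u12 u21 u22.
        (u11, u12, u21, u22) \<in> matrices A n n' t U V \<and> (u11, u12) \<in> W' \<longrightarrow> (u21, u22) \<in> S \<times> S"
              proof (intro bexI allI impI)
        show "S \<times> S \<in> \<U>" "S \<times> S \<in> \<V>" using UV by (simp_all add: is_filter_on_def)
      qed (use Ltop top in auto)
      show "\<exists>U\<in>\<U>. \<exists>V\<in>\<V>. \<exists>W'\<in>L. \<forall>u11 u12 u21 u22.
        (u11, u12, u21, u22) \<in> matrices A n n' t U V \<and> (u11, u12) \<in> W' \<longrightarrow> (u21, u22) \<in> P \<inter> Q"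
        if P: "\<exists>U\<in>\<U>. \<exists>V\<in>\<V>. \<exists>W'\<in>L. \<forall>u11 u12 u21 u22.
          (u11, u12, u21, u22) \<in> matrices A n n' t U V \<and> (u11, u12) \<in> W' \<longrightarrow> (u21, u22) \<in> P"
        and Q: "\<exists>U\<in>\<U>. \<exists>V\<in>\<V>. \<exists>W'\<in>L. \<forall>u11 u12 u21 u22.
          (u11, u12, u21, u22) \<in> matrices A n n' t U V \<and> (u11, u12) \<in> W' \<longrightarrow> (u21, u22) \<in> Q" for P Q
      proof -
        from P obtain U1 V1 W1 where 1: "U1 \<in> \<U>" "V1 \<in> \<V>" "W1 \<in> L" "\<And>u11 u12 u21 u22.
          (u11, u12, u21, u22) \<in> matrices A n n' t U1 V1 \<Longrightarrow> (u11, u12) \<in> W1 \<Longrightarrow> (u21, u22) \<in> P"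
          by blast
        from Q obtain U2 V2 W2 where 2: "U2 \<in> \<U>" "V2 \<in> \<V>" "W2 \<in> L" "\<And>u11 u12 u21 u22.
          (u11, u12, u21, u22) \<in> matrices A n n' t U2 V2 \<Longrightarrow> (u11, u12) \<in> W2 \<Longrightarrow> (u21, u22) \<in> Q"
          by blast
        have "U1 \<inter> U2 \<in> \<U>" "V1 \<inter> V2 \<in> \<V>"
          using UV 1(1,2) 2(1,2) by (simp_all add: is_filter_on_def)
        moreover have sub: "matrices A n n' t (U1 \<inter> U2) (V1 \<inter> V2) \<subseteq> matrices A n n' t U1 V1"
          "matrices A n n' t (U1 \<inter> U2) (V1 \<inter> V2) \<subseteq> matrices A n n' t U2 V2"
          by (rule matrices_mono; blast)+
        ultimately show ?thesis
        proof (intro bexI[OF _ \<open>U1 \<inter> U2 \<in> \<U>\<close>] bexI[OF _ \<open>V1 \<inter> V2 \<in> \<V>\<close>]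
            bexI[OF _ Lint[OF 1(3) 2(3)]] allI impI)
          fix u11 u12 u21 u22
          assume *: "(u11, u12, u21, u22) \<in> matrices A n n' t (U1 \<inter> U2) (V1 \<inter> V2) \<and> (u11, u12) \<in> W1 \<inter> W2"
          have "(u21, u22) \<in> P" by (rule 1(4)) (use * sub in blast)+
          moreover have "(u21, u22) \<in> Q" by (rule 2(4)) (use * sub in blast)+
          ultimately show "(u21, u22) \<in> P \<inter> Q" ..
        qed
      qed
    qed (meson subsetD)
  qed
  have "is_uniformity S L" unfolding is_uniformity_def using LF refl sym comp by blast
  moreover have "compatible \<Sigma> A L" unfolding compatible_def using compat by blast
  moreover have "term_condition \<Sigma> A \<U> \<V> L" unfolding term_condition_def using tc by blast
  ultimately have "L \<in> K" by (simp add: K_def Unif_def S_def)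
  moreover have "K \<subseteq> carrier (Unif \<Sigma> A)" by (auto simp: K_def)
  ultimately have L: "least (Unif \<Sigma> A) L K"
    using KL by (auto simp: least_def Unif_def)
  moreover have "\<W> = L" if "least (Unif \<Sigma> A) \<W> K" for \<W>
    using that L by (auto simp: least_def Unif_def)
  ultimately have "commutator \<Sigma> A \<U> \<V> = L"
    unfolding commutator_def K_def[symmetric] by (rule the_equality)
  with L show ?thesis by (simp add: K_def)
qed

end

theory Submission
  imports Defs
begin

text \<open>Everything but symmetry holds in every variety: \<open>\<U>\<close> and \<open>\<V>\<close> satisfy the term
  condition for \<open>\<U>, \<V>\<close> themselves because terms are uniformly continuous, and the term condition
  passes to larger filters \<open>\<U>\<close> and is preserved by inverse images.  For symmetry, Day's theorem
  provides quaternary terms \<open>m\<^sub>0, \<dots>, m\<^sub>N\<close>, and the term condition for \<open>\<V>, \<U>\<close>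
  makes \<open>m\<^sub>i(u\<^sub>2\<^sub>1, u\<^sub>2\<^sub>1, u\<^sub>2\<^sub>2, u\<^sub>2\<^sub>2)\<close> and
  \<open>m\<^sub>i(u\<^sub>2\<^sub>1, u\<^sub>1\<^sub>1, u\<^sub>1\<^sub>2, u\<^sub>2\<^sub>2)\<close> uniformly close for each \<open>\<U>\<close>-\<open>\<V>\<close>-matrix; by the uniform
  shifting lemma this forces \<open>u\<^sub>2\<^sub>1\<close> and \<open>u\<^sub>2\<^sub>2\<close> to be close as soon as
  \<open>u\<^sub>1\<^sub>1\<close> and \<open>u\<^sub>1\<^sub>2\<close> are.\<close>

section \<open>Terms, homomorphisms and congruences\<close>

fun subst :: "('v \<Rightarrow> ('f, 'w) trm) \<Rightarrow> ('f, 'v) trm \<Rightarrow> ('f, 'w) trm" where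
  "subst \<sigma> (Var v) = \<sigma> v"
| "subst \<sigma> (App g ts) = App g (map (subst \<sigma>) ts)"

lemma wf_trm_subst: "wf_trm \<Sigma> t \<Longrightarrow> (\<And>v. wf_trm \<Sigma> (\<sigma> v)) \<Longrightarrow> wf_trm \<Sigma> (subst \<sigma> t)"
  by (induction t) auto

lemma vars_trm_subst: "vars_trm (subst \<sigma> t) = (\<Union>v\<in>vars_trm t. vars_trm (\<sigma> v))"
  by (induction t) auto

lemma trm_val_subst: "trm_val A \<rho> (subst \<sigma> t) = trm_val A (\<lambda>v. trm_val A \<rho> (\<sigma> v)) t"
  by (induction t) (simp_all cong: map_cong)

lemma trm_val_cong:
  "(\<And>v. v \<in> vars_trm t \<Longrightarrow> \<rho> v = \<rho>' v) \<Longrightarrow> trm_val A \<rho> t = trm_val A \<rho>' t"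
proof (induction t)
  case (App g ts)
  then have "map (trm_val A \<rho>) ts = map (trm_val A \<rho>') ts" by auto
  then show ?case by (simp only: trm_val.simps)
qed simp

lemma trm_val_closed:
  assumes "is_algebra \<Sigma> A" and "wf_trm \<Sigma> t" and "\<rho> ` vars_trm t \<subseteq> carrier A"
  shows "trm_val A \<rho> t \<in> carrier A"
  using assms(2,3)
proof (induction t)
  case (App g ts)
  then have "set (map (trm_val A \<rho>) ts) \<subseteq> carrier A" by fastforce
  with App.prems assms(1) show ?case
    unfolding is_algebra_def by (metis length_map trm_val.simps(2) wf_trm.simps(2))
qed auto

lemma hom_trm_val:
  assumes "is_algebra \<Sigma> B" and "is_hom \<Sigma> B A h"
    and "wf_trm \<Sigma> t" and "\<rho> ` vars_trm t \<subseteq> carrier B"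
  shows "h (trm_val B \<rho> t) = trm_val A (\<lambda>v. h (\<rho> v)) t"
  using assms(3,4)
proof (induction t)
  case (App g ts)
  have "set (map (trm_val B \<rho>) ts) \<subseteq> carrier B"
    using App.prems by (fastforce intro: trm_val_closed[OF assms(1)])
  then have "h (oper B g (map (trm_val B \<rho>) ts)) = oper A g (map h (map (trm_val B \<rho>) ts))"
    using assms(2) App.prems(1) unfolding is_hom_def by (metis length_map wf_trm.simps(2))
  moreover have "map h (map (trm_val B \<rho>) ts) = map (trm_val A (\<lambda>v. h (\<rho> v))) ts"
    using App by (auto simp: subset_iff)
  ultimately show ?case by (simp only: trm_val.simps)
qed simp

section \<open>Congruences: joint kernels, intersections and joins\<close>

lemma list_all2_subset_carrier:
  assumes "list_all2 (\<lambda>x y. (x, y) \<in> r) xs ys" and "r \<subseteq> S \<times> S"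
  shows "set xs \<subseteq> S" "set ys \<subseteq> S"
  using assms by (induction rule: list_all2_induct) auto

text \<open>Homomorphisms commute with the operations, so agreement under all of \<open>H\<close> is
  preserved by them. With families of evaluations for \<open>H\<close>, this supplies the three
  congruences of Day's argument without describing them by generators.\<close>

lemma is_congruence_kernels:
  assumes A: "is_algebra \<Sigma> A" and hom: "\<And>h. h \<in> H \<Longrightarrow> is_hom \<Sigma> A B h"
  shows "is_congruence \<Sigma> A {(x, y) \<in> carrier A \<times> carrier A. \<forall>h\<in>H. h x = h y}"
    (is "is_congruence _ _ ?\<theta>")
  unfolding is_congruence_def
proof (intro conjI allI impI)
  show "equiv (carrier A) ?\<theta>"
    by (auto simp: equiv_def refl_on_def sym_def trans_def)
next
  fix g n xs ys
  assume *: "\<Sigma> g = Some n \<and> length xs = n \<and> length ys = n \<and> list_all2 (\<lambda>x y. (x, y) \<in> ?\<theta>) xs ys"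
  then have xy: "list_all2 (\<lambda>x y. (x, y) \<in> ?\<theta>) xs ys" by blast
  then have c: "set xs \<subseteq> carrier A" "set ys \<subseteq> carrier A"
    by (rule list_all2_subset_carrier, blast)+
  have "h (oper A g xs) = h (oper A g ys)" if h: "h \<in> H" for h
  proof -
    have "map h xs = map h ys"
      using xy by (induction rule: list_all2_induct) (use h in auto)
    with hom[OF h] * c show ?thesis unfolding is_hom_def by metis
  qed
  moreover have "oper A g xs \<in> carrier A" "oper A g ys \<in> carrier A"
    using A * c unfolding is_algebra_def by blast+
  ultimately show "(oper A g xs, oper A g ys) \<in> ?\<theta>" by blast
qed

lemma is_congruence_Int:
  assumes "is_congruence \<Sigma> A \<alpha>" and "is_congruence \<Sigma> A \<beta>"
  shows "is_congruence \<Sigma> A (\<alpha> \<inter> \<beta>)"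
  unfolding is_congruence_def
proof (intro conjI allI impI)
  show "equiv (carrier A) (\<alpha> \<inter> \<beta>)"
    using assms unfolding is_congruence_def equiv_def refl_on_def sym_def trans_def by blast
next
  fix g n xs ys
  assume *: "\<Sigma> g = Some n \<and> length xs = n \<and> length ys = n \<and> list_all2 (\<lambda>x y. (x, y) \<in> \<alpha> \<inter> \<beta>) xs ys"
  then have "list_all2 (\<lambda>x y. (x, y) \<in> \<alpha>) xs ys" "list_all2 (\<lambda>x y. (x, y) \<in> \<beta>) xs ys"
    by (auto elim!: list_all2_mono)
  with * assms show "(oper A g xs, oper A g ys) \<in> \<alpha> \<inter> \<beta>"
    unfolding is_congruence_def by blast
qed

text \<open>Arguments are replaced one at a time. Each replacement follows a chain whose links are
  single \<alpha>- or \<beta>-steps, the other arguments being fixed by reflexivity. The result is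
  the join of \<alpha> and \<beta>.\<close>

lemma is_congruence_trancl_Un:
  assumes \<alpha>: "is_congruence \<Sigma> A \<alpha>" and \<beta>: "is_congruence \<Sigma> A \<beta>"
  shows "is_congruence \<Sigma> A ((\<alpha> \<union> \<beta>)\<^sup>+)"
  unfolding is_congruence_def
proof (intro conjI allI impI)
  have e: "equiv (carrier A) \<alpha>" "equiv (carrier A) \<beta>"
    using assms by (simp_all add: is_congruence_def)
  show "equiv (carrier A) ((\<alpha> \<union> \<beta>)\<^sup>+)"
  proof (rule equivI)
    show "(\<alpha> \<union> \<beta>)\<^sup>+ \<subseteq> carrier A \<times> carrier A"
      by (rule trancl_subset_Sigma) (use e in \<open>auto simp: equiv_def\<close>)
    show "refl_on (carrier A) ((\<alpha> \<union> \<beta>)\<^sup>+)"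
      using e by (auto simp: equiv_def refl_on_def)
    show "sym ((\<alpha> \<union> \<beta>)\<^sup>+)"
      using e by (intro sym_trancl sym_Un) (auto simp: equiv_def)
  qed simp
  fix g n xs ys
  assume *: "\<Sigma> g = Some n \<and> length xs = n \<and> length ys = n \<and>
    list_all2 (\<lambda>x y. (x, y) \<in> (\<alpha> \<union> \<beta>)\<^sup>+) xs ys"
  have refl: "list_all2 (\<lambda>x y. (x, y) \<in> \<theta>) us us"
    if "\<theta> = \<alpha> \<or> \<theta> = \<beta>" "set us \<subseteq> carrier A" for us \<theta>
    using that e by (auto simp: list.rel_refl_strong equiv_def refl_on_def intro!: list.rel_refl_strong)
  have step: "(oper A g (us @ x # vs), oper A g (us @ y # vs)) \<in> \<alpha> \<union> \<beta>"
    if "(x, y) \<in> \<alpha> \<union> \<beta>" "set us \<subseteq> carrier A" "set vs \<subseteq> carrier A" "Suc (length us + length vs) = n"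
    for x y us vs
  proof -
    from that(1) obtain \<theta> where \<theta>: "\<theta> = \<alpha> \<or> \<theta> = \<beta>" "(x, y) \<in> \<theta>" by blast
    have "list_all2 (\<lambda>x y. (x, y) \<in> \<theta>) (us @ x # vs) (us @ y # vs)"
      using refl[OF \<theta>(1)] that \<theta>(2) by (auto intro!: list_all2_appendI)
    moreover have "is_congruence \<Sigma> A \<theta>" using \<theta>(1) assms by blast
    ultimately have "(oper A g (us @ x # vs), oper A g (us @ y # vs)) \<in> \<theta>"
      unfolding is_congruence_def using * that(4) by auto
    with \<theta>(1) show ?thesis by blast
  qed
  have steps: "(oper A g (us @ x # vs), oper A g (us @ y # vs)) \<in> (\<alpha> \<union> \<beta>)\<^sup>+"
    if "(x, y) \<in> (\<alpha> \<union> \<beta>)\<^sup>+" and c: "set us \<subseteq> carrier A" "set vs \<subseteq> carrier A" "Suc (length us + length vs) = n"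
    for x y us vs
    using that(1)
    by (induction rule: trancl_induct) (use step[OF _ c] in \<open>blast intro: trancl_into_trancl\<close>)+
  have r: "(\<alpha> \<union> \<beta>)\<^sup>+ \<subseteq> carrier A \<times> carrier A"
    by (rule trancl_subset_Sigma) (use e in \<open>auto simp: equiv_def\<close>)
  \<comment> \<open>The list \<open>us\<close> collects the arguments already replaced. The first
    alternative is for the end of the list, where no replacement is left and hence no pair of the
    transitive closure is at hand.\<close>
  have "us @ xs = us @ ys \<or> (oper A g (us @ xs), oper A g (us @ ys)) \<in> (\<alpha> \<union> \<beta>)\<^sup>+"
    if "list_all2 (\<lambda>x y. (x, y) \<in> (\<alpha> \<union> \<beta>)\<^sup>+) xs ys" "set us \<subseteq> carrier A" "length us + length xs = n"
    for us xs ys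
    using that
  proof (induction xs ys arbitrary: us rule: list_all2_induct)
    case (Cons x xs y ys)
    have xy: "x \<in> carrier A" "y \<in> carrier A" "set xs \<subseteq> carrier A"
      using Cons.hyps r list_all2_subset_carrier[OF _ r] by blast+
    have "(oper A g (us @ x # xs), oper A g (us @ y # xs)) \<in> (\<alpha> \<union> \<beta>)\<^sup>+"
      using steps Cons.hyps(1) Cons.prems xy by simp
    moreover have "us @ y # xs = us @ y # ys \<or>
        (oper A g (us @ y # xs), oper A g (us @ y # ys)) \<in> (\<alpha> \<union> \<beta>)\<^sup>+"
      using Cons.IH[of "us @ [y]"] Cons.prems xy by simp
    ultimately show ?case by (metis trancl_trans)
  qed simp
  from this[of xs ys "[]"] * have "xs = ys \<or> (oper A g xs, oper A g ys) \<in> (\<alpha> \<union> \<beta>)\<^sup>+"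
    by simp
  \<comment> \<open>This case includes constants: compatibility of \<alpha> with the operation
    relates the value to itself.\<close>
  moreover have "(oper A g xs, oper A g xs) \<in> \<alpha>" if "xs = ys"
    using \<alpha> * refl[of \<alpha> xs] list_all2_subset_carrier[OF _ r] unfolding is_congruence_def by blast
  ultimately show "(oper A g xs, oper A g ys) \<in> (\<alpha> \<union> \<beta>)\<^sup>+" by blast
qed

text \<open>Translates the abstract modular law into relations between elements. A join is
  transitive and so contains the transitive closure of the union, which is itself a congruence and
  so bounds the join from above; the meet is compared with the intersection.\<close>

lemma modular_Con_trancl:
  assumes mod: "modular_lattice (Con \<Sigma> A)"
    and con: "is_congruence \<Sigma> A \<alpha>" "is_congruence \<Sigma> A \<beta>" "is_congruence \<Sigma> A \<gamma>" and "\<gamma> \<subseteq> \<beta>"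
  shows "\<beta> \<inter> (\<alpha> \<union> \<gamma>)\<^sup>+ \<subseteq> (\<gamma> \<union> (\<alpha> \<inter> \<beta>))\<^sup>+"
proof -
  let ?L = "Con \<Sigma> A"
  from mod interpret lattice ?L by (simp add: modular_lattice_def)
  have C: "x \<in> carrier ?L \<longleftrightarrow> is_congruence \<Sigma> A x" and le: "x \<sqsubseteq>\<^bsub>?L\<^esub> y \<longleftrightarrow> x \<subseteq> y" for x y
    by (simp_all add: Con_def)
  have c: "\<alpha> \<in> carrier ?L" "\<beta> \<in> carrier ?L" "\<gamma> \<in> carrier ?L" using con by (simp_all add: C)
  have j: "is_congruence \<Sigma> A (\<gamma> \<squnion>\<^bsub>?L\<^esub> \<alpha>)" "\<gamma> \<subseteq> \<gamma> \<squnion>\<^bsub>?L\<^esub> \<alpha>" "\<alpha> \<subseteq> \<gamma> \<squnion>\<^bsub>?L\<^esub> \<alpha>"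
    using join_closed join_left join_right c unfolding C le by blast+
  then have "trans (\<gamma> \<squnion>\<^bsub>?L\<^esub> \<alpha>)" by (simp add: is_congruence_def equiv_def)
  then have "(\<gamma> \<squnion>\<^bsub>?L\<^esub> \<alpha>)\<^sup>+ = \<gamma> \<squnion>\<^bsub>?L\<^esub> \<alpha>" by (rule trancl_id)
  with j have "(\<alpha> \<union> \<gamma>)\<^sup>+ \<subseteq> \<gamma> \<squnion>\<^bsub>?L\<^esub> \<alpha>" using trancl_mono_subset[of "\<alpha> \<union> \<gamma>"] by blast
  moreover have "(\<gamma> \<squnion>\<^bsub>?L\<^esub> \<alpha>) \<inter> \<beta> \<subseteq> (\<gamma> \<squnion>\<^bsub>?L\<^esub> \<alpha>) \<sqinter>\<^bsub>?L\<^esub> \<beta>"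
    using meet_le[of "(\<gamma> \<squnion>\<^bsub>?L\<^esub> \<alpha>) \<inter> \<beta>" "\<gamma> \<squnion>\<^bsub>?L\<^esub> \<alpha>" \<beta>] is_congruence_Int[OF j(1) con(2)] j(1) con(2)
    unfolding C le by blast
  moreover have "(\<gamma> \<squnion>\<^bsub>?L\<^esub> \<alpha>) \<sqinter>\<^bsub>?L\<^esub> \<beta> = \<gamma> \<squnion>\<^bsub>?L\<^esub> (\<alpha> \<sqinter>\<^bsub>?L\<^esub> \<beta>)"
    using mod c \<open>\<gamma> \<subseteq> \<beta>\<close> unfolding modular_lattice_def le by blast
  moreover have "\<gamma> \<squnion>\<^bsub>?L\<^esub> (\<alpha> \<sqinter>\<^bsub>?L\<^esub> \<beta>) \<subseteq> (\<gamma> \<union> (\<alpha> \<inter> \<beta>))\<^sup>+"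
  proof -
    have "\<alpha> \<sqinter>\<^bsub>?L\<^esub> \<beta> \<subseteq> \<alpha> \<inter> \<beta>" using meet_left meet_right c unfolding le by blast
    moreover have "\<alpha> \<sqinter>\<^bsub>?L\<^esub> \<beta> \<in> carrier ?L" using c by simp
    moreover have "(\<gamma> \<union> (\<alpha> \<inter> \<beta>))\<^sup>+ \<in> carrier ?L"
      unfolding C by (intro is_congruence_trancl_Un is_congruence_Int con)
    moreover have "\<gamma> \<union> (\<alpha> \<inter> \<beta>) \<subseteq> (\<gamma> \<union> (\<alpha> \<inter> \<beta>))\<^sup>+" by auto
    ultimately show ?thesis
      using join_le[of \<gamma> "(\<gamma> \<union> (\<alpha> \<inter> \<beta>))\<^sup>+" "\<alpha> \<sqinter>\<^bsub>?L\<^esub> \<beta>"] c unfolding le by blast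
  qed
  ultimately show ?thesis by blast
qed

section \<open>The relatively free algebra and Day terms\<close>

text \<open>Terms are identified when they agree on all valuations in \<open>A\<close>, so this is the free algebra of
  countable rank in the subvariety generated by \<open>A\<close>.\<close>

definition term_class :: "'f signature \<Rightarrow> ('f, 'a) algebra \<Rightarrow> ('f, nat) trm \<Rightarrow> ('f, nat) trm set" where
  "term_class \<Sigma> A t =
    {s. wf_trm \<Sigma> s \<and> (\<forall>\<rho>. range \<rho> \<subseteq> carrier A \<longrightarrow> trm_val A \<rho> s = trm_val A \<rho> t)}"

definition free_algebra :: "'f signature \<Rightarrow> ('f, 'a) algebra \<Rightarrow> ('f, ('f, nat) trm set) algebra" where
  "free_algebra \<Sigma> A = \<lparr>carrier = term_class \<Sigma> A ` {t. wf_trm \<Sigma> t},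
    oper = \<lambda>g Xs. term_class \<Sigma> A (App g (map (\<lambda>X. SOME t. t \<in> X) Xs))\<rparr>"

text \<open>For \<rho> with values in \<open>A\<close>, this is the homomorphism from the free
  algebra to \<open>A\<close> that sends the class of variable \<open>k\<close> to
  \<open>\<rho> k\<close>.\<close>

definition eval :: "('f, 'a) algebra \<Rightarrow> (nat \<Rightarrow> 'a) \<Rightarrow> ('f, nat) trm set \<Rightarrow> 'a" where
  "eval A \<rho> X = trm_val A \<rho> (SOME t. t \<in> X)"

lemma some_in_term_class: "wf_trm \<Sigma> t \<Longrightarrow> (SOME s. s \<in> term_class \<Sigma> A t) \<in> term_class \<Sigma> A t"
  by (rule someI[of _ t]) (simp add: term_class_def)

lemma eval_term_class:
  "wf_trm \<Sigma> t \<Longrightarrow> range \<rho> \<subseteq> carrier A \<Longrightarrow> eval A \<rho> (term_class \<Sigma> A t) = trm_val A \<rho> t"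
  using some_in_term_class[of \<Sigma> t A] by (simp add: eval_def term_class_def)

lemma free_algebra_eqI:
  assumes "X \<in> carrier (free_algebra \<Sigma> A)" and "Y \<in> carrier (free_algebra \<Sigma> A)"
    and "\<And>\<rho>. range \<rho> \<subseteq> carrier A \<Longrightarrow> eval A \<rho> X = eval A \<rho> Y"
  shows "X = Y"
proof -
  from assms obtain s t where st: "X = term_class \<Sigma> A s" "wf_trm \<Sigma> s" "Y = term_class \<Sigma> A t" "wf_trm \<Sigma> t"
    by (auto simp: free_algebra_def)
  then have "trm_val A \<rho> s = trm_val A \<rho> t" if "range \<rho> \<subseteq> carrier A" for \<rho>
    using assms(3)[OF that] that by (simp add: eval_term_class)
  then show ?thesis unfolding st term_class_def by auto
qed

lemma wf_trm_some_in:
  assumes "X \<in> carrier (free_algebra \<Sigma> A)"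
  shows "wf_trm \<Sigma> (SOME t. t \<in> X)"
  using assms some_in_term_class[of \<Sigma> _ A] by (auto simp: free_algebra_def term_class_def)

lemma is_algebra_free_algebra: "is_algebra \<Sigma> (free_algebra \<Sigma> A)"
  unfolding is_algebra_def
proof (intro allI impI)
  fix g n Xs
  assume *: "\<Sigma> g = Some n \<and> length Xs = n \<and> set Xs \<subseteq> carrier (free_algebra \<Sigma> A)"
  then have "wf_trm \<Sigma> (App g (map (\<lambda>X. SOME t. t \<in> X) Xs))"
    using wf_trm_some_in by (auto simp: subset_iff)
  then show "oper (free_algebra \<Sigma> A) g Xs \<in> carrier (free_algebra \<Sigma> A)"
    by (simp add: free_algebra_def)
qed

lemma is_hom_eval:
  assumes "is_algebra \<Sigma> A" and \<rho>: "range \<rho> \<subseteq> carrier A"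
  shows "is_hom \<Sigma> (free_algebra \<Sigma> A) A (eval A \<rho>)"
  unfolding is_hom_def
proof (intro conjI allI impI)
  show "eval A \<rho> \<in> carrier (free_algebra \<Sigma> A) \<rightarrow> carrier A"
    unfolding eval_def using assms wf_trm_some_in by (intro funcsetI trm_val_closed) auto
next
  fix g n Xs
  assume *: "\<Sigma> g = Some n \<and> length Xs = n \<and> set Xs \<subseteq> carrier (free_algebra \<Sigma> A)"
  then have "wf_trm \<Sigma> (App g (map (\<lambda>X. SOME t. t \<in> X) Xs))"
    using wf_trm_some_in by (auto simp: subset_iff)
  from eval_term_class[OF this \<rho>]
  show "eval A \<rho> (oper (free_algebra \<Sigma> A) g Xs) = oper A g (map (eval A \<rho>) Xs)"
    by (simp add: free_algebra_def eval_def[abs_def] comp_def)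
qed

text \<open>The evaluations separate the points of the free algebra, so it inherits the identities
  of \<open>A\<close>.\<close>

lemma in_variety_free_algebra:
  assumes "wf_identities \<Sigma> E" and A: "in_variety \<Sigma> E A"
  shows "in_variety \<Sigma> E (free_algebra \<Sigma> A)"
proof -
  let ?F = "free_algebra \<Sigma> A"
  note F = is_algebra_free_algebra[of \<Sigma> A]
  have alg: "is_algebra \<Sigma> A" using A by (simp add: in_variety_def)
  have "trm_val ?F \<rho> s = trm_val ?F \<rho> t" if st: "(s, t) \<in> E" and \<rho>: "range \<rho> \<subseteq> carrier ?F" for s t \<rho>
  proof (rule free_algebra_eqI)
    have wf: "wf_trm \<Sigma> s" "wf_trm \<Sigma> t" using assms(1) st by (auto simp: wf_identities_def)
    have c: "\<rho> ` V \<subseteq> carrier ?F" for V using \<rho> by blast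
    show "trm_val ?F \<rho> s \<in> carrier ?F" "trm_val ?F \<rho> t \<in> carrier ?F"
      using trm_val_closed[OF F _ c] wf by blast+
    fix \<tau> :: "nat \<Rightarrow> 'b" assume \<tau>: "range \<tau> \<subseteq> carrier A"
    note h = is_hom_eval[OF alg \<tau>]
    have "range (\<lambda>v. eval A \<tau> (\<rho> v)) \<subseteq> carrier A"
      using h \<rho> by (auto simp: is_hom_def Pi_iff)
    with A st have "trm_val A (\<lambda>v. eval A \<tau> (\<rho> v)) s = trm_val A (\<lambda>v. eval A \<tau> (\<rho> v)) t"
      unfolding in_variety_def by blast
    then show "eval A \<tau> (trm_val ?F \<rho> s) = eval A \<tau> (trm_val ?F \<rho> t)"
      by (simp add: hom_trm_val[OF F h _ c] wf)
  qed
  with F show ?thesis unfolding in_variety_def by blast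
qed

text \<open>Every variable from 3 on receives \<open>d\<close>, so a term in arbitrarily many
  variables acts as a quaternary operation. The type is polymorphic because \<open>quad\<close>
  serves both as a valuation and as a substitution.\<close>

definition quad :: "'a \<Rightarrow> 'a \<Rightarrow> 'a \<Rightarrow> 'a \<Rightarrow> nat \<Rightarrow> 'a" where
  "quad a b c d k = (if k = 0 then a else if k = 1 then b else if k = 2 then c else d)"

lemma range_quad: "range (quad a b c d) \<subseteq> S" if "a \<in> S" "b \<in> S" "c \<in> S" "d \<in> S"
  using that by (auto simp: quad_def)

text \<open>Day's condition, required in \<open>A\<close> only. A disjunction replaces the usual
  alternation between even and odd \<open>i\<close>, since the terms come from a chain whose two
  kinds of links follow in any order.\<close>

definition day_terms :: "'f signature \<Rightarrow> ('f, 'a) algebra \<Rightarrow> nat \<Rightarrow> (nat \<Rightarrow> ('f, nat) trm) \<Rightarrow> bool" where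
  "day_terms \<Sigma> A N m \<longleftrightarrow>
    (\<forall>i\<le>N. wf_trm \<Sigma> (m i)) \<and>
    (\<forall>a\<in>carrier A. \<forall>b\<in>carrier A. \<forall>c\<in>carrier A. \<forall>d\<in>carrier A.
      trm_val A (quad a b c d) (m 0) = a \<and> trm_val A (quad a b c d) (m N) = d) \<and>
    (\<forall>i\<le>N. \<forall>a\<in>carrier A. \<forall>b\<in>carrier A. trm_val A (quad a b b a) (m i) = a) \<and>
    (\<forall>i<N.
      (\<forall>a\<in>carrier A. \<forall>c\<in>carrier A. trm_val A (quad a a c c) (m i) = trm_val A (quad a a c c) (m (Suc i))) \<or>
      (\<forall>a\<in>carrier A. \<forall>b\<in>carrier A. \<forall>d\<in>carrier A.
        trm_val A (quad a b b d) (m i) = trm_val A (quad a b b d) (m (Suc i))))"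

text \<open>Day's theorem: with \<open>x, y, z, u\<close> the first four generators of the free algebra and
  \<open>\<alpha>\<close>, \<open>\<beta>\<close>, \<open>\<gamma>\<close> the congruences generated by \<open>x = y, z = u\<close>, by \<open>x = u, y = z\<close> and by
  \<open>y = z\<close> (here realised as joint kernels of evaluations), the pair \<open>(x, u)\<close> lies in \<open>\<beta> \<inter> (\<alpha> \<or> \<gamma>)\<close>, hence in \<open>\<gamma> \<or> (\<alpha> \<inter> \<beta>)\<close>.  The terms
  are read off a chain witnessing this.\<close>

lemma day_terms_exist:
  assumes wfE: "wf_identities \<Sigma> E" and cm: "congruence_modular \<Sigma> E" and A: "in_variety \<Sigma> E A"
  obtains N m where "day_terms \<Sigma> A N m"
proof -
  let ?F = "free_algebra \<Sigma> A" and ?S = "carrier A"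
  note F = is_algebra_free_algebra[of \<Sigma> A]
  have alg: "is_algebra \<Sigma> A" using A by (simp add: in_variety_def)
  define ker where "ker P = {(X, Y) \<in> carrier ?F \<times> carrier ?F. \<forall>h\<in>eval A ` P. h X = h Y}" for P
  have ker: "is_congruence \<Sigma> ?F (ker P)" if "\<And>\<rho>. \<rho> \<in> P \<Longrightarrow> range \<rho> \<subseteq> ?S" for P
    unfolding ker_def by (rule is_congruence_kernels[OF F]) (use that is_hom_eval[OF alg] in blast)
  define \<alpha> where "\<alpha> = ker {quad a a c c | a c. a \<in> ?S \<and> c \<in> ?S}"
  define \<beta> where "\<beta> = ker {quad a b b a | a b. a \<in> ?S \<and> b \<in> ?S}"
  define \<gamma> where "\<gamma> = ker {quad a b b d | a b d. a \<in> ?S \<and> b \<in> ?S \<and> d \<in> ?S}"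
  have con: "is_congruence \<Sigma> ?F \<alpha>" "is_congruence \<Sigma> ?F \<beta>" "is_congruence \<Sigma> ?F \<gamma>"
    unfolding \<alpha>_def \<beta>_def \<gamma>_def by (rule ker; auto simp: quad_def)+
  define gen where "gen k = term_class \<Sigma> A (Var k)" for k
  have gen: "gen k \<in> carrier ?F" for k by (simp add: gen_def free_algebra_def)
  have ev: "eval A (quad a b c d) (gen k) = quad a b c d k"
    if "a \<in> ?S" "b \<in> ?S" "c \<in> ?S" "d \<in> ?S" for a b c d k
    using range_quad[OF that] by (simp add: gen_def eval_term_class)
  \<comment> \<open>These three links lead from \<open>x\<close> over \<open>y\<close> and
    \<open>z\<close> to \<open>u\<close>.\<close>
  have "(gen 0, gen 1) \<in> \<alpha>" "(gen 1, gen 2) \<in> \<gamma>" "(gen 2, gen 3) \<in> \<alpha>"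
    unfolding \<alpha>_def \<gamma>_def ker_def using gen by (auto simp: ev quad_def)
  then have "(gen 0, gen 3) \<in> (\<alpha> \<union> \<gamma>)\<^sup>+"
    by (meson Un_iff r_into_trancl' trancl_into_trancl)
  moreover have "(gen 0, gen 3) \<in> \<beta>"
    unfolding \<beta>_def ker_def using gen by (auto simp: ev quad_def)
  moreover have "\<gamma> \<subseteq> \<beta>" unfolding \<beta>_def \<gamma>_def ker_def by blast
  \<comment> \<open>The only use of congruence modularity: the free algebra belongs to the variety
    and consists of sets of terms, as the algebras in \<open>congruence_modular\<close> do.\<close>
  moreover have "modular_lattice (Con \<Sigma> ?F)"
    using cm in_variety_free_algebra[OF wfE A] unfolding congruence_modular_def by blast
  ultimately have "(gen 0, gen 3) \<in> (\<gamma> \<union> (\<alpha> \<inter> \<beta>))\<^sup>+"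
    using modular_Con_trancl[OF _ con] by blast
  then obtain N where "(gen 0, gen 3) \<in> (\<gamma> \<union> (\<alpha> \<inter> \<beta>)) ^^ N"
    unfolding trancl_power by blast
  then obtain f where f: "f 0 = gen 0" "f N = gen 3"
    and step: "\<And>i. i < N \<Longrightarrow> (f i, f (Suc i)) \<in> \<gamma> \<union> (\<alpha> \<inter> \<beta>)"
    unfolding relpow_fun_conv by blast
  \<comment> \<open>All links lie in \<beta>, so every member of the chain is \<beta>-related to
    \<open>x\<close>. This becomes the identity \<open>m\<^sub>i(a, b, b, a) = a\<close>.\<close>
  have \<beta>: "(f 0, f i) \<in> \<beta>" if "i \<le> N" for i
    using that
  proof (induction i)
    case 0
    show ?case using con(2) gen f(1) by (auto simp: is_congruence_def equiv_def refl_on_def)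
  next
    case (Suc i)
    then have "(f 0, f i) \<in> \<beta>" "(f i, f (Suc i)) \<in> \<beta>" using step[of i] \<open>\<gamma> \<subseteq> \<beta>\<close> by auto
    then show ?case using con(2) unfolding is_congruence_def equiv_def trans_def by blast
  qed
  define m where "m i = (SOME t. t \<in> f i)" for i
  have val: "trm_val A \<rho> (m i) = eval A \<rho> (f i)" for \<rho> i by (simp add: m_def eval_def)
  have fc: "f i \<in> carrier ?F" if "i \<le> N" for i
    using \<beta>[OF that] by (auto simp: \<beta>_def ker_def)
  have "day_terms \<Sigma> A N m"
    unfolding day_terms_def
  proof (intro conjI allI impI ballI)
    show "wf_trm \<Sigma> (m i)" if "i \<le> N" for i
      unfolding m_def by (rule wf_trm_some_in[OF fc[OF that]])
    show "trm_val A (quad a b c d) (m 0) = a" "trm_val A (quad a b c d) (m N) = d"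
      if "a \<in> ?S" "b \<in> ?S" "c \<in> ?S" "d \<in> ?S" for a b c d
      unfolding val f using that by (simp_all add: ev quad_def)
    show "trm_val A (quad a b b a) (m i) = a" if "i \<le> N" "a \<in> ?S" "b \<in> ?S" for i a b
    proof -
      have "eval A (quad a b b a) (f 0) = eval A (quad a b b a) (f i)"
        using \<beta>[OF that(1)] that unfolding \<beta>_def ker_def by blast
      then show ?thesis unfolding val using that by (simp add: f(1) ev quad_def)
    qed
    fix i assume "i < N"
    then have "(f i, f (Suc i)) \<in> \<gamma> \<or> (f i, f (Suc i)) \<in> \<alpha>" using step by blast
    moreover have "eval A (quad a a c c) (f i) = eval A (quad a a c c) (f (Suc i))"
      if "(f i, f (Suc i)) \<in> \<alpha>" "a \<in> ?S" "c \<in> ?S" for a c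
      using that unfolding \<alpha>_def ker_def by blast
    moreover have "eval A (quad a b b d) (f i) = eval A (quad a b b d) (f (Suc i))"
      if "(f i, f (Suc i)) \<in> \<gamma>" "a \<in> ?S" "b \<in> ?S" "d \<in> ?S" for a b d
      using that unfolding \<gamma>_def ker_def by blast
    ultimately show "(\<forall>a\<in>?S. \<forall>c\<in>?S. trm_val A (quad a a c c) (m i) = trm_val A (quad a a c c) (m (Suc i))) \<or>
      (\<forall>a\<in>?S. \<forall>b\<in>?S. \<forall>d\<in>?S. trm_val A (quad a b b d) (m i) = trm_val A (quad a b b d) (m (Suc i)))"
      unfolding val by blast
  qed
  then show thesis by (rule that)
qed

section \<open>Compatible uniformities\<close>

context
  fixes \<Sigma> :: "'f signature" and A :: "('f, 'a) algebra" and \<U> :: "('a \<times> 'a) set set"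
  assumes \<U>: "\<U> \<in> carrier (Unif \<Sigma> A)"
begin

lemma Unif_top: "carrier A \<times> carrier A \<in> \<U>"
  and Unif_subset: "U \<in> \<U> \<Longrightarrow> U \<subseteq> carrier A \<times> carrier A"
  and Unif_upward: "U \<in> \<U> \<Longrightarrow> U \<subseteq> V \<Longrightarrow> V \<subseteq> carrier A \<times> carrier A \<Longrightarrow> V \<in> \<U>"
  and Unif_Int: "U \<in> \<U> \<Longrightarrow> V \<in> \<U> \<Longrightarrow> U \<inter> V \<in> \<U>"
  and Unif_refl: "U \<in> \<U> \<Longrightarrow> x \<in> carrier A \<Longrightarrow> (x, x) \<in> U"
  and Unif_converse: "U \<in> \<U> \<Longrightarrow> U\<inverse> \<in> \<U>"
  and Unif_comp: "U \<in> \<U> \<Longrightarrow> \<exists>V\<in>\<U>. V O V \<subseteq> U"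
  using \<U> unfolding Unif_def is_uniformity_def is_filter_on_def refl_on_def by auto

lemma Unif_compatible:
  assumes "\<Sigma> g = Some n" and "U \<in> \<U>"
  shows "\<exists>U'\<in>\<U>. \<forall>xs ys. length xs = n \<and> length ys = n \<and> list_all2 (\<lambda>x y. (x, y) \<in> U') xs ys \<longrightarrow>
    (oper A g xs, oper A g ys) \<in> U"
  using \<U> assms unfolding Unif_def compatible_def by simp

text \<open>The full square as an extra factor covers the case of empty \<open>I\<close>.\<close>

lemma Unif_INT: "finite I \<Longrightarrow> (\<And>i. i \<in> I \<Longrightarrow> U i \<in> \<U>) \<Longrightarrow> (carrier A \<times> carrier A) \<inter> (\<Inter>i\<in>I. U i) \<in> \<U>"
proof (induction rule: finite_induct)
  case (insert i I)
  then have "U i \<inter> ((carrier A \<times> carrier A) \<inter> (\<Inter>i\<in>I. U i)) \<in> \<U>" by (simp add: Unif_Int)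
  then show ?case by (simp add: Int_ac)
qed (simp add: Unif_top)

text \<open>Intersecting a half of \<open>U\<close> with its converse makes two pairs with a common
  left point composable.\<close>

lemma Unif_half:
  assumes "U \<in> \<U>"
  obtains V where "V \<in> \<U>" and "\<And>x y z. (x, y) \<in> V \<Longrightarrow> (x, z) \<in> V \<Longrightarrow> (y, z) \<in> U"
proof -
  from Unif_comp[OF assms] obtain V where V: "V \<in> \<U>" "V O V \<subseteq> U" by blast
  show thesis
    by (rule that[OF Unif_Int[OF V(1) Unif_converse[OF V(1)]]]) (use V(2) in blast)
qed

text \<open>Each further link costs one more halving of \<open>U\<close>. For \<open>N = 0\<close>
  the claim is reflexivity at \<open>f 0\<close>, whence the carrier hypothesis.\<close>

lemma Unif_chain:
  assumes "U \<in> \<U>"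
  obtains V where "V \<in> \<U>"
    and "\<And>f. f 0 \<in> carrier A \<Longrightarrow> (\<And>i. i < N \<Longrightarrow> (f i, f (Suc i)) \<in> V) \<Longrightarrow> (f 0, f N) \<in> U"
proof -
  have "\<exists>V\<in>\<U>. \<forall>f. f 0 \<in> carrier A \<longrightarrow> (\<forall>i<N. (f i, f (Suc i)) \<in> V) \<longrightarrow> (f 0, f N) \<in> U"
    using assms
  proof (induction N arbitrary: U)
    case 0
    then show ?case using Unif_refl by blast
  next
    case (Suc N)
    from Unif_comp[OF Suc.prems] obtain U' where U': "U' \<in> \<U>" "U' O U' \<subseteq> U" by blast
    from Suc.IH[OF U'(1)] obtain V where V: "V \<in> \<U>"
      "\<And>f. f 0 \<in> carrier A \<Longrightarrow> \<forall>i<N. (f i, f (Suc i)) \<in> V \<Longrightarrow> (f 0, f N) \<in> U'" by blast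
    have "(f 0, f (Suc N)) \<in> U" if "f 0 \<in> carrier A" "\<forall>i<Suc N. (f i, f (Suc i)) \<in> V \<inter> U'" for f
    proof -
      have "(f 0, f N) \<in> U'" "(f N, f (Suc N)) \<in> U'" using V(2)[of f] that by auto
      with U'(2) show ?thesis by blast
    qed
    with Unif_Int[OF V(1) U'(1)] show ?case by blast
  qed
  then show thesis using that by blast
qed

text \<open>Compatibility of the outermost operation gives a relation to be met by its arguments;
  the relations that achieve this for the finitely many subterms are intersected.\<close>

lemma trm_val_uniformly_continuous:
  assumes "wf_trm \<Sigma> t" and "U \<in> \<U>"
  obtains U' where "U' \<in> \<U>"
    and "\<And>\<rho> \<rho>'. (\<And>v. v \<in> vars_trm t \<Longrightarrow> (\<rho> v, \<rho>' v) \<in> U') \<Longrightarrow> (trm_val A \<rho> t, trm_val A \<rho>' t) \<in> U"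
proof -
  have "\<exists>U'\<in>\<U>. \<forall>\<rho> \<rho>'. (\<forall>v\<in>vars_trm t. (\<rho> v, \<rho>' v) \<in> U') \<longrightarrow> (trm_val A \<rho> t, trm_val A \<rho>' t) \<in> U"
    using assms
  proof (induction t arbitrary: U)
    case (Var v)
    then show ?case by auto
  next
    case (App g ts)
    then have g: "\<Sigma> g = Some (length ts)" by simp
    from Unif_compatible[OF g App.prems(2)] obtain U0 where U0: "U0 \<in> \<U>"
      "\<And>xs ys. length xs = length ts \<and> length ys = length ts \<and>
        list_all2 (\<lambda>x y. (x, y) \<in> U0) xs ys \<Longrightarrow> (oper A g xs, oper A g ys) \<in> U"
      by blast
    have "\<forall>t\<in>set ts. \<exists>U'\<in>\<U>. \<forall>\<rho> \<rho>'. (\<forall>v\<in>vars_trm t. (\<rho> v, \<rho>' v) \<in> U') \<longrightarrow>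
        (trm_val A \<rho> t, trm_val A \<rho>' t) \<in> U0"
      using App.IH[OF _ _ U0(1)] App.prems(1) by simp
    then obtain V where V: "\<And>t. t \<in> set ts \<Longrightarrow> V t \<in> \<U>"
      "\<And>t \<rho> \<rho>'. t \<in> set ts \<Longrightarrow> \<forall>v\<in>vars_trm t. (\<rho> v, \<rho>' v) \<in> V t \<Longrightarrow>
        (trm_val A \<rho> t, trm_val A \<rho>' t) \<in> U0"
      by metis
    let ?V = "(carrier A \<times> carrier A) \<inter> (\<Inter>t\<in>set ts. V t)"
    have "(trm_val A \<rho> (App g ts), trm_val A \<rho>' (App g ts)) \<in> U"
      if "\<forall>v\<in>vars_trm (App g ts). (\<rho> v, \<rho>' v) \<in> ?V" for \<rho> \<rho>'
    proof -
      have "(trm_val A \<rho> t, trm_val A \<rho>' t) \<in> U0" if "t \<in> set ts" for t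
        by (rule V(2)[OF that]) (use \<open>\<forall>v\<in>vars_trm (App g ts). _\<close> that in auto)
      then have "list_all2 (\<lambda>x y. (x, y) \<in> U0) (map (trm_val A \<rho>) ts) (map (trm_val A \<rho>') ts)"
        by (simp add: list.rel_map list.rel_refl_strong)
      then have "(oper A g (map (trm_val A \<rho>) ts), oper A g (map (trm_val A \<rho>') ts)) \<in> U"
        by (intro U0(2)) simp_all
      then show ?thesis by (simp only: trm_val.simps)
    qed
    moreover have "?V \<in> \<U>" using V(1) by (intro Unif_INT) auto
    ultimately show ?case by blast
  qed
  then show thesis using that by blast
qed

end

section \<open>Uniformities from filter bases, and meets\<close>

lemma Unif_le: "\<U> \<sqsubseteq>\<^bsub>Unif \<Sigma> A\<^esub> \<V> \<longleftrightarrow> \<V> \<subseteq> \<U>"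
  by (simp add: Unif_def)

text \<open>All axioms ask for sufficiently small relations, so checking them on a base is enough.
  Both meets and inverse images are built this way.\<close>

lemma Unif_from_base:
  fixes A :: "('f, 'a) algebra"
  assumes ne: "\<B> \<noteq> {}" and sub: "\<And>P. P \<in> \<B> \<Longrightarrow> P \<subseteq> carrier A \<times> carrier A"
    and int: "\<And>P Q. P \<in> \<B> \<Longrightarrow> Q \<in> \<B> \<Longrightarrow> \<exists>R\<in>\<B>. R \<subseteq> P \<inter> Q"
    and refl: "\<And>P x. P \<in> \<B> \<Longrightarrow> x \<in> carrier A \<Longrightarrow> (x, x) \<in> P"
    and conv: "\<And>P. P \<in> \<B> \<Longrightarrow> \<exists>Q\<in>\<B>. Q \<subseteq> P\<inverse>"
    and comp: "\<And>P. P \<in> \<B> \<Longrightarrow> \<exists>Q\<in>\<B>. Q O Q \<subseteq> P"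
    and compat: "\<And>g n P. \<Sigma> g = Some n \<Longrightarrow> P \<in> \<B> \<Longrightarrow> \<exists>Q\<in>\<B>. \<forall>xs ys.
      length xs = n \<and> length ys = n \<and> list_all2 (\<lambda>x y. (x, y) \<in> Q) xs ys \<longrightarrow>
        (oper A g xs, oper A g ys) \<in> P"
  shows "{P. P \<subseteq> carrier A \<times> carrier A \<and> (\<exists>Q\<in>\<B>. Q \<subseteq> P)} \<in> carrier (Unif \<Sigma> A)"
proof -
  let ?S = "carrier A \<times> carrier A"
  define \<U> where "\<U> = {P. P \<subseteq> ?S \<and> (\<exists>Q\<in>\<B>. Q \<subseteq> P)}"
  have I: "P \<in> \<U>" if "Q \<in> \<B>" "Q \<subseteq> P" "P \<subseteq> ?S" for P Q
    using that by (auto simp: \<U>_def)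
  have base: "P \<in> \<U>" if "P \<in> \<B>" for P
    by (rule I[OF that order_refl sub[OF that]])
  have E: "\<exists>Q\<in>\<B>. Q \<subseteq> P" and S: "P \<subseteq> ?S" if "P \<in> \<U>" for P
    using that by (simp_all add: \<U>_def)
  have "is_filter_on ?S \<U>"
    unfolding is_filter_on_def
  proof (intro conjI ballI allI impI; (elim conjE)?)
    show "\<U> \<subseteq> Pow ?S" using S by blast
    from ne obtain P where P: "P \<in> \<B>" by blast
    show "?S \<in> \<U>" by (rule I[OF P sub[OF P] order_refl])
    show "Q \<in> \<U>" if P: "P \<in> \<U>" and "P \<subseteq> Q" "Q \<subseteq> ?S" for P Q
    proof -
      from E[OF P] obtain R where "R \<in> \<B>" "R \<subseteq> P" by blast
      with that(2,3) show ?thesis by (intro I[of R]) simp_all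
    qed
    show "P \<inter> Q \<in> \<U>" if P: "P \<in> \<U>" and Q: "Q \<in> \<U>" for P Q
    proof -
      from E[OF P] obtain P' where P': "P' \<in> \<B>" "P' \<subseteq> P" by blast
      from E[OF Q] obtain Q' where Q': "Q' \<in> \<B>" "Q' \<subseteq> Q" by blast
      from int[OF P'(1) Q'(1)] obtain R where "R \<in> \<B>" "R \<subseteq> P' \<inter> Q'" by blast
      then show ?thesis by (intro I[of R]) (use P'(2) Q'(2) S[OF P] in blast)+
    qed
  qed
  moreover have "refl_on (carrier A) U" if "U \<in> \<U>" for U
    unfolding refl_on_def using E[OF that] refl by blast
  moreover have "U\<inverse> \<in> \<U>" if U: "U \<in> \<U>" for U
  proof -
    from E[OF U] obtain P where P: "P \<in> \<B>" "P \<subseteq> U" by blast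
    from conv[OF P(1)] obtain Q where "Q \<in> \<B>" "Q \<subseteq> P\<inverse>" by blast
    then show ?thesis by (intro I[of Q]) (use P(2) S[OF U] in blast)+
  qed
  moreover have "\<exists>V\<in>\<U>. V O V \<subseteq> U" if U: "U \<in> \<U>" for U
  proof -
    from E[OF U] obtain P where P: "P \<in> \<B>" "P \<subseteq> U" by blast
    from comp[OF P(1)] obtain Q where Q: "Q \<in> \<B>" "Q O Q \<subseteq> P" by blast
    show ?thesis by (rule bexI[OF _ base[OF Q(1)]]) (use Q(2) P(2) in simp)
  qed
  moreover have "compatible \<Sigma> A \<U>"
    unfolding compatible_def
  proof (intro allI impI ballI)
    fix g n U assume g: "\<Sigma> g = Some n" and U: "U \<in> \<U>"
    from E[OF U] obtain P where P: "P \<in> \<B>" "P \<subseteq> U" by blast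
    from compat[OF g P(1)] obtain Q where Q: "Q \<in> \<B>" and "\<forall>xs ys. length xs = n \<and> length ys = n \<and>
        list_all2 (\<lambda>x y. (x, y) \<in> Q) xs ys \<longrightarrow> (oper A g xs, oper A g ys) \<in> P"
      by (elim bexE)
    with P(2) show "\<exists>U'\<in>\<U>. \<forall>xs ys. length xs = n \<and> length ys = n \<and>
        list_all2 (\<lambda>x y. (x, y) \<in> U') xs ys \<longrightarrow> (oper A g xs, oper A g ys) \<in> U"
      by (intro bexI[OF _ base[OF Q]]) (simp add: subset_iff)
  qed
  ultimately have "\<U> \<in> carrier (Unif \<Sigma> A)"
    by (simp add: Unif_def is_uniformity_def)
  then show ?thesis by (simp only: \<U>_def)
qed

text \<open>The lattice operation is an arbitrary choice among greatest lower bounds, so one has to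
  be exhibited. As the order is reverse inclusion, it is the smallest filter containing both
  uniformities, with the intersections \<open>U \<inter> V\<close> as a base.\<close>

lemma greatest_meet_Unif:
  fixes A :: "('f, 'a) algebra"
  assumes U: "\<U> \<in> carrier (Unif \<Sigma> A)" and V: "\<V> \<in> carrier (Unif \<Sigma> A)"
  shows "greatest (Unif \<Sigma> A) (\<U> \<sqinter>\<^bsub>Unif \<Sigma> A\<^esub> \<V>) (Lower (Unif \<Sigma> A) {\<U>, \<V>})"
proof -
  define \<B> where "\<B> = {U \<inter> V | U V. U \<in> \<U> \<and> V \<in> \<V>}"
  define \<M> where "\<M> = {P. P \<subseteq> carrier A \<times> carrier A \<and> (\<exists>Q\<in>\<B>. Q \<subseteq> P)}"
  have I: "P \<inter> Q \<in> \<B>" if "P \<in> \<U>" "Q \<in> \<V>" for P Q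
    using that by (auto simp: \<B>_def)
  have E: thesis if "P \<in> \<B>" "\<And>U V. P = U \<inter> V \<Longrightarrow> U \<in> \<U> \<Longrightarrow> V \<in> \<V> \<Longrightarrow> thesis" for P thesis
    using that by (auto simp: \<B>_def)
  have M: "\<M> \<in> carrier (Unif \<Sigma> A)"
    unfolding \<M>_def
  proof (rule Unif_from_base)
    show "\<B> \<noteq> {}" using I[OF Unif_top[OF U] Unif_top[OF V]] by blast
    fix P assume "P \<in> \<B>"
    then obtain U' V' where P: "P = U' \<inter> V'" "U' \<in> \<U>" "V' \<in> \<V>" by (rule E)
    show "P \<subseteq> carrier A \<times> carrier A"
      using P(1) Unif_subset[OF U P(2)] by blast
    show "(x, x) \<in> P" if "x \<in> carrier A" for x
      unfolding P(1) using Unif_refl[OF U P(2) that] Unif_refl[OF V P(3) that] by (rule IntI)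
    show "\<exists>R\<in>\<B>. R \<subseteq> P \<inter> Q" if "Q \<in> \<B>" for Q
    proof -
      from that obtain U2 V2 where Q: "Q = U2 \<inter> V2" "U2 \<in> \<U>" "V2 \<in> \<V>" by (rule E)
      show ?thesis
        by (rule bexI[OF _ I[OF Unif_Int[OF U P(2) Q(2)] Unif_Int[OF V P(3) Q(3)]]]) (auto simp: P(1) Q(1))
    qed
    show "\<exists>Q\<in>\<B>. Q \<subseteq> P\<inverse>"
      by (rule bexI[OF _ I[OF Unif_converse[OF U P(2)] Unif_converse[OF V P(3)]]]) (auto simp: P(1))
    show "\<exists>Q\<in>\<B>. Q O Q \<subseteq> P"
    proof -
      from Unif_comp[OF U P(2)] obtain U1 where U1: "U1 \<in> \<U>" "U1 O U1 \<subseteq> U'" by blast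
      from Unif_comp[OF V P(3)] obtain V1 where V1: "V1 \<in> \<V>" "V1 O V1 \<subseteq> V'" by blast
      show ?thesis by (rule bexI[OF _ I[OF U1(1) V1(1)]]) (use U1(2) V1(2) P(1) in blast)
    qed
    show "\<exists>Q\<in>\<B>. \<forall>xs ys. length xs = n \<and> length ys = n \<and>
        list_all2 (\<lambda>x y. (x, y) \<in> Q) xs ys \<longrightarrow> (oper A g xs, oper A g ys) \<in> P"
      if g: "\<Sigma> g = Some n" for g n
    proof -
      from Unif_compatible[OF U g P(2)] obtain U1 where U1: "U1 \<in> \<U>"
        "\<And>xs ys. length xs = n \<and> length ys = n \<and>
          list_all2 (\<lambda>x y. (x, y) \<in> U1) xs ys \<Longrightarrow> (oper A g xs, oper A g ys) \<in> U'"
        by blast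
      from Unif_compatible[OF V g P(3)] obtain V1 where V1: "V1 \<in> \<V>"
        "\<And>xs ys. length xs = n \<and> length ys = n \<and>
          list_all2 (\<lambda>x y. (x, y) \<in> V1) xs ys \<Longrightarrow> (oper A g xs, oper A g ys) \<in> V'"
        by blast
      have "(oper A g xs, oper A g ys) \<in> P"
        if "length xs = n" "length ys = n" "list_all2 (\<lambda>x y. (x, y) \<in> U1 \<inter> V1) xs ys" for xs ys
      proof -
        from that have "list_all2 (\<lambda>x y. (x, y) \<in> U1) xs ys" "list_all2 (\<lambda>x y. (x, y) \<in> V1) xs ys"
          by (auto elim!: list_all2_mono)
        with that(1,2) show ?thesis unfolding P(1) by (intro IntI U1(2) V1(2) conjI)
      qed
      then show ?thesis by (intro bexI[OF _ I[OF U1(1) V1(1)]]) simp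
    qed
  qed
  have "P \<in> \<M>" if "P \<in> \<U>" for P
    unfolding \<M>_def using Unif_subset[OF U that] I[OF that Unif_top[OF V]] by blast
  moreover have "P \<in> \<M>" if "P \<in> \<V>" for P
    unfolding \<M>_def using Unif_subset[OF V that] I[OF Unif_top[OF U] that] by blast
  ultimately have "\<U> \<subseteq> \<M>" "\<V> \<subseteq> \<M>" by (simp_all add: subset_iff)
  moreover have "\<M> \<subseteq> \<W>" if W: "\<W> \<in> carrier (Unif \<Sigma> A)" and "\<U> \<subseteq> \<W>" "\<V> \<subseteq> \<W>" for \<W>
  proof
    fix P assume "P \<in> \<M>"
    then obtain Q where Q: "Q \<in> \<B>" "Q \<subseteq> P" "P \<subseteq> carrier A \<times> carrier A" by (auto simp: \<M>_def)
    from Q(1) obtain U' V' where "Q = U' \<inter> V'" "U' \<in> \<U>" "V' \<in> \<V>" by (rule E)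
    with that have "Q \<in> \<W>" using Unif_Int[OF W] by (simp add: subset_iff)
    then show "P \<in> \<W>" by (rule Unif_upward[OF W _ Q(2,3)])
  qed
  ultimately have "greatest (Unif \<Sigma> A) \<M> (Lower (Unif \<Sigma> A) {\<U>, \<V>})"
    using M U V by (auto simp: greatest_def Lower_def Unif_le)
  then show ?thesis unfolding meet_def inf_def by (rule someI)
qed

section \<open>Inverse images of uniformities\<close>

lemma inverse_image_unif_eq:
  fixes A :: "('f, 'a) algebra" and B :: "('f, 'b) algebra"
  assumes U: "\<U> \<in> carrier (Unif \<Sigma> A)"
  shows "inverse_image_unif B h \<U> = {P. P \<subseteq> carrier B \<times> carrier B \<and>
    (\<exists>Q\<in>inverse_image_rel (carrier B) h ` \<U>. Q \<subseteq> P)}" (is "?I = ?J")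
proof (rule equalityI; rule subsetI)
  define T where "T = carrier B \<times> carrier B"
  define r where "r = inverse_image_rel (carrier B) h"
  have G: "r ` \<U> \<subseteq> Pow T" by (auto simp: inverse_image_rel_def r_def T_def)
  have IJ: "?I = generated_filter T (r ` \<U>)" "?J = {P. P \<subseteq> T \<and> (\<exists>U\<in>\<U>. r U \<subseteq> P)}"
    by (simp_all add: inverse_image_unif_def T_def r_def)
  show "P \<in> ?I" if "P \<in> ?J" for P
  proof -
    from that obtain U where P: "P \<subseteq> T" "U \<in> \<U>" "r U \<subseteq> P" unfolding IJ by blast
    have "P \<in> F" if "is_filter_on T F \<and> r ` \<U> \<subseteq> F" for F
    proof -
      from that P(2) have "r U \<in> F" by blast
      with that P(1,3) show ?thesis unfolding is_filter_on_def by simp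
    qed
    then show ?thesis unfolding IJ generated_filter_def by simp
  qed
  fix P assume "P \<in> ?I"
  then have "P \<in> generated_filter T (r ` \<U>)" by (simp only: IJ)
  then have "P \<subseteq> T \<and> (\<exists>U\<in>\<U>. r U \<subseteq> P)" using G
  proof (rule generated_filter_induct)
    show "T \<subseteq> T \<and> (\<exists>U\<in>\<U>. r U \<subseteq> T)" using G Unif_top[OF U] by blast
    show "P \<subseteq> T \<and> (\<exists>U\<in>\<U>. r U \<subseteq> P)" if "P \<in> r ` \<U>" for P using that G by blast
    show "Q \<subseteq> T \<and> (\<exists>U\<in>\<U>. r U \<subseteq> Q)" if "P \<subseteq> T \<and> (\<exists>U\<in>\<U>. r U \<subseteq> P)" "P \<subseteq> Q" "Q \<subseteq> T" for P Q
      using that by (meson order_trans)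
    fix P Q
    assume P: "P \<subseteq> T \<and> (\<exists>U\<in>\<U>. r U \<subseteq> P)" and Q: "Q \<subseteq> T \<and> (\<exists>U\<in>\<U>. r U \<subseteq> Q)"
    then obtain U1 U2 where 1: "U1 \<in> \<U>" "r U1 \<subseteq> P" "U2 \<in> \<U>" "r U2 \<subseteq> Q" by blast
    \<comment> \<open>Preimages respect intersections, so they form a filter base and their
      supersets already make up the generated filter.\<close>
    have "r (U1 \<inter> U2) \<subseteq> P \<inter> Q"
      using 1(2,4) by (auto simp: inverse_image_rel_def r_def)
    moreover have "U1 \<inter> U2 \<in> \<U>" using Unif_Int[OF U] 1 by blast
    ultimately show "P \<inter> Q \<subseteq> T \<and> (\<exists>U\<in>\<U>. r U \<subseteq> P \<inter> Q)" using P by blast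
  qed
  then show "P \<in> ?J" by (simp only: IJ mem_Collect_eq)
qed

lemma inverse_image_unif_closed:
  fixes A :: "('f, 'a) algebra" and B :: "('f, 'b) algebra"
  assumes U: "\<U> \<in> carrier (Unif \<Sigma> A)" and B: "is_algebra \<Sigma> B" and h: "is_hom \<Sigma> B A h"
  shows "inverse_image_unif B h \<U> \<in> carrier (Unif \<Sigma> B)"
  unfolding inverse_image_unif_eq[OF U]
proof (rule Unif_from_base; (elim imageE)?)
  let ?r = "inverse_image_rel (carrier B) h"
  show "?r ` \<U> \<noteq> {}" using Unif_top[OF U] by blast
  have hc: "h x \<in> carrier A" if "x \<in> carrier B" for x
    using h that by (auto simp: is_hom_def)
  show "(x, x) \<in> P" if "P = ?r U" "U \<in> \<U>" "x \<in> carrier B" for P U x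
    using that hc Unif_refl[OF U] by (simp add: inverse_image_rel_def)
  show "P \<subseteq> carrier B \<times> carrier B" if "P = ?r U" for P U
    using that by (auto simp: inverse_image_rel_def)
  show "\<exists>R\<in>?r ` \<U>. R \<subseteq> P \<inter> Q" if "P = ?r U1" "U1 \<in> \<U>" "Q = ?r U2" "U2 \<in> \<U>" for P Q U1 U2
    by (rule bexI[of _ "?r (U1 \<inter> U2)"])
      (use that Unif_Int[OF U] in \<open>auto simp: inverse_image_rel_def\<close>)
  show "\<exists>Q\<in>?r ` \<U>. Q \<subseteq> P\<inverse>" if "P = ?r U1" "U1 \<in> \<U>" for P U1
    by (rule bexI[of _ "?r (U1\<inverse>)"])
      (use that Unif_converse[OF U] in \<open>auto simp: inverse_image_rel_def\<close>)
  show "\<exists>Q\<in>?r ` \<U>. Q O Q \<subseteq> P" if P: "P = ?r U1" "U1 \<in> \<U>" for P U1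
  proof -
    from Unif_comp[OF U P(2)] obtain V where "V \<in> \<U>" "V O V \<subseteq> U1" by blast
    moreover from this have "?r V O ?r V \<subseteq> P" using P(1) by (auto simp: inverse_image_rel_def)
    ultimately show ?thesis by blast
  qed
  show "\<exists>Q\<in>?r ` \<U>. \<forall>xs ys. length xs = n \<and> length ys = n \<and>
      list_all2 (\<lambda>x y. (x, y) \<in> Q) xs ys \<longrightarrow> (oper B g xs, oper B g ys) \<in> P"
    if g: "\<Sigma> g = Some n" and P: "P = ?r U1" "U1 \<in> \<U>" for g n P U1
  proof -
    from Unif_compatible[OF U g P(2)] obtain V where V: "V \<in> \<U>"
      "\<And>xs ys. length xs = n \<and> length ys = n \<and>
        list_all2 (\<lambda>x y. (x, y) \<in> V) xs ys \<Longrightarrow> (oper A g xs, oper A g ys) \<in> U1"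
      by blast
    have "(oper B g xs, oper B g ys) \<in> P"
      if xy: "length xs = n" "length ys = n" "list_all2 (\<lambda>x y. (x, y) \<in> ?r V) xs ys" for xs ys
    proof -
      have c: "set xs \<subseteq> carrier B" "set ys \<subseteq> carrier B"
        using list_all2_subset_carrier[OF xy(3)] by (auto simp: inverse_image_rel_def)
      have "list_all2 (\<lambda>x y. (x, y) \<in> V) (map h xs) (map h ys)"
        using xy(3) by (auto simp: list.rel_map inverse_image_rel_def elim!: list_all2_mono)
      then have "(oper A g (map h xs), oper A g (map h ys)) \<in> U1" using V(2) xy by simp
      moreover have "h (oper B g xs) = oper A g (map h xs)" "h (oper B g ys) = oper A g (map h ys)"
        using h g xy c unfolding is_hom_def by blast+
      moreover have "oper B g xs \<in> carrier B" "oper B g ys \<in> carrier B"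
        using B g xy c unfolding is_algebra_def by blast+
      ultimately show ?thesis unfolding P(1) inverse_image_rel_def by simp
    qed
    with V(1) show ?thesis by blast
  qed
qed

section \<open>The term condition\<close>

lemma matricesE:
  assumes "(u11, u12, u21, u22) \<in> matrices A n n' t U V"
  obtains a a' b c where
    "u11 = trm_val A ((!) (a @ b)) t" "u12 = trm_val A ((!) (a @ c)) t"
    "u21 = trm_val A ((!) (a' @ b)) t" "u22 = trm_val A ((!) (a' @ c)) t"
    "length a = n" "length a' = n" "length b = n'" "length c = n'"
    "set a \<subseteq> carrier A" "set a' \<subseteq> carrier A" "set b \<subseteq> carrier A" "set c \<subseteq> carrier A"
    "list_all2 (\<lambda>x y. (x, y) \<in> U) a a'" "list_all2 (\<lambda>x y. (x, y) \<in> V) b c"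
  using assms unfolding matrices_def by blast

lemma matricesI:
  assumes "length a = n" "length a' = n" "length b = n'" "length c = n'"
    and "set a \<subseteq> carrier A" "set a' \<subseteq> carrier A" "set b \<subseteq> carrier A" "set c \<subseteq> carrier A"
    and "list_all2 (\<lambda>x y. (x, y) \<in> U) a a'" "list_all2 (\<lambda>x y. (x, y) \<in> V) b c"
    and "u11 = trm_val A ((!) (a @ b)) t" "u12 = trm_val A ((!) (a @ c)) t"
      "u21 = trm_val A ((!) (a' @ b)) t" "u22 = trm_val A ((!) (a' @ c)) t"
  shows "(u11, u12, u21, u22) \<in> matrices A n n' t U V"
  using assms unfolding matrices_def by blast

lemma nth_image_carrier: "length xs = m \<Longrightarrow> set xs \<subseteq> S \<Longrightarrow> V \<subseteq> {..<m} \<Longrightarrow> (!) xs ` V \<subseteq> S"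
  by (force simp: subset_iff)

lemma matrices_closed:
  assumes A: "is_algebra \<Sigma> A" and t: "wf_trm \<Sigma> t" "vars_trm t \<subseteq> {..<n + n'}"
    and m: "(u11, u12, u21, u22) \<in> matrices A n n' t U V"
  shows "u11 \<in> carrier A" "u12 \<in> carrier A" "u21 \<in> carrier A" "u22 \<in> carrier A"
  using m by (elim matricesE; simp; intro trm_val_closed[OF A t(1)] nth_image_carrier[OF _ _ t(2)]; simp)+

lemma list_all2_refl_carrier:
  assumes "\<U> \<in> carrier (Unif \<Sigma> A)" and "U \<in> \<U>" and "set xs \<subseteq> carrier A"
  shows "list_all2 (\<lambda>x y. (x, y) \<in> U) xs xs"
  using assms Unif_refl[OF assms(1,2)] by (auto intro!: list.rel_refl_strong)

text \<open>Entries in one column differ only in the first block of arguments, entries in one row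
  only in the second. Uniform continuity of \<open>t\<close> therefore bounds columns through the
  first relation and rows through the second, whatever the other relation is.\<close>

lemma matrices_rows_columns:
  assumes \<W>: "\<W> \<in> carrier (Unif \<Sigma> A)" and t: "wf_trm \<Sigma> t" "vars_trm t \<subseteq> {..<n + n'}" and "W \<in> \<W>"
  obtains W' where "W' \<in> \<W>"
    and "\<And>u11 u12 u21 u22 V. (u11, u12, u21, u22) \<in> matrices A n n' t W' V \<Longrightarrow> (u11, u21) \<in> W \<and> (u12, u22) \<in> W"
    and "\<And>u11 u12 u21 u22 U. (u11, u12, u21, u22) \<in> matrices A n n' t U W' \<Longrightarrow> (u21, u22) \<in> W"
proof -
  obtain W' where W': "W' \<in> \<W>"
    and *: "\<And>\<rho> \<rho>'. (\<And>v. v \<in> vars_trm t \<Longrightarrow> (\<rho> v, \<rho>' v) \<in> W') \<Longrightarrow> (trm_val A \<rho> t, trm_val A \<rho>' t) \<in> W"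
    using trm_val_uniformly_continuous[OF \<W> t(1) \<open>W \<in> \<W>\<close>] by blast
  have close: "(trm_val A ((!) xs) t, trm_val A ((!) ys) t) \<in> W"
    if "length xs = n + n'" "list_all2 (\<lambda>x y. (x, y) \<in> W') xs ys" for xs ys
    using that t(2) by (intro *) (auto simp: list_all2_conv_all_nth)
  note refl = list_all2_refl_carrier[OF \<W> W']
  show thesis
  proof (rule that[OF W'])
    show "(u11, u21) \<in> W \<and> (u12, u22) \<in> W" if "(u11, u12, u21, u22) \<in> matrices A n n' t W' V"
      for u11 u12 u21 u22 V
      using that by (rule matricesE) (auto intro!: close list_all2_appendI refl)
    show "(u21, u22) \<in> W" if "(u11, u12, u21, u22) \<in> matrices A n n' t U W'"
      for u11 u12 u21 u22 U
      using that by (rule matricesE) (auto intro!: close list_all2_appendI refl)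
  qed
qed

text \<open>If the columns are close, \<open>u21\<close> is close to \<open>u11\<close>, then to
  \<open>u12\<close> by the first row, then to \<open>u22\<close>. This yields the bound of the
  commutator by \<open>\<U>\<close>.\<close>

lemma term_condition_left:
  assumes U: "\<U> \<in> carrier (Unif \<Sigma> A)" and V: "\<V> \<in> carrier (Unif \<Sigma> A)"
  shows "term_condition \<Sigma> A \<U> \<V> \<U>"
  unfolding term_condition_def
proof (intro allI impI ballI)
  fix n n' :: nat and t W assume t: "wf_trm \<Sigma> t \<and> vars_trm t \<subseteq> {..<n + n'}" and "W \<in> \<U>"
  obtain W1 where W1: "W1 \<in> \<U>" "\<And>x y z. (x, y) \<in> W1 \<Longrightarrow> (x, z) \<in> W1 \<Longrightarrow> (y, z) \<in> W"
    using Unif_half[OF U \<open>W \<in> \<U>\<close>] by blast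
  \<comment> \<open>From \<open>u11\<close> one link leads to \<open>u21\<close>, but two links
    through \<open>u12\<close> lead to \<open>u22\<close>; \<open>W2\<close> is small enough for
    both.\<close>
  from Unif_comp[OF U W1(1)] obtain W2 where W2: "W2 \<in> \<U>" "W2 O W2 \<subseteq> W1" by blast
  have sub: "W2 \<subseteq> W1"
    using W2 Unif_refl[OF U W2(1)] Unif_subset[OF U W2(1)] by blast
  obtain W' where W': "W' \<in> \<U>" "\<And>u11 u12 u21 u22 V. (u11, u12, u21, u22) \<in> matrices A n n' t W' V \<Longrightarrow>
      (u11, u21) \<in> W2 \<and> (u12, u22) \<in> W2"
    using matrices_rows_columns[OF U _ _ W2(1)] t by metis
  have "(u21, u22) \<in> W"
    if "(u11, u12, u21, u22) \<in> matrices A n n' t W' (carrier A \<times> carrier A) \<and> (u11, u12) \<in> W2"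
    for u11 u12 u21 u22
    by (rule W1(2)[of u11]) (use W'(2) that W2(2) sub in blast)+
  then show "\<exists>U\<in>\<U>. \<exists>V\<in>\<V>. \<exists>W'\<in>\<U>. \<forall>u11 u12 u21 u22.
      (u11, u12, u21, u22) \<in> matrices A n n' t U V \<and> (u11, u12) \<in> W' \<longrightarrow> (u21, u22) \<in> W"
    using W'(1) W2(1) Unif_top[OF V] by blast
qed

text \<open>Uniform continuity in the second block makes \<open>u21\<close> and \<open>u22\<close>
  close for any first row. This yields the bound of the commutator by \<open>\<V>\<close>.\<close>

lemma term_condition_right:
  assumes U: "\<U> \<in> carrier (Unif \<Sigma> A)" and V: "\<V> \<in> carrier (Unif \<Sigma> A)"
  shows "term_condition \<Sigma> A \<U> \<V> \<V>"
  unfolding term_condition_def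
proof (intro allI impI ballI)
  fix n n' :: nat and t W assume t: "wf_trm \<Sigma> t \<and> vars_trm t \<subseteq> {..<n + n'}" and "W \<in> \<V>"
  obtain W' where "W' \<in> \<V>"
    "\<And>u11 u12 u21 u22 U. (u11, u12, u21, u22) \<in> matrices A n n' t U W' \<Longrightarrow> (u21, u22) \<in> W"
    using matrices_rows_columns[OF V _ _ \<open>W \<in> \<V>\<close>] t by metis
  then show "\<exists>U\<in>\<U>. \<exists>V\<in>\<V>. \<exists>W'\<in>\<V>. \<forall>u11 u12 u21 u22.
      (u11, u12, u21, u22) \<in> matrices A n n' t U V \<and> (u11, u12) \<in> W' \<longrightarrow> (u21, u22) \<in> W"
    using Unif_top[OF U] by blast
qed

text \<open>A larger filter offers more choices of \<open>U\<close>. Since the order is reverse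
  inclusion, this is the source of monotonicity.\<close>

lemma term_condition_antimono:
  assumes "term_condition \<Sigma> A \<U>' \<V> \<W>" and "\<U>' \<subseteq> \<U>"
  shows "term_condition \<Sigma> A \<U> \<V> \<W>"
  unfolding term_condition_def
proof (intro allI impI ballI)
  fix n n' :: nat and t W assume t: "wf_trm \<Sigma> t \<and> vars_trm t \<subseteq> {..<n + n'}" and "W \<in> \<W>"
  then have "\<exists>U\<in>\<U>'. \<exists>V\<in>\<V>. \<exists>W'\<in>\<W>. \<forall>u11 u12 u21 u22.
      (u11, u12, u21, u22) \<in> matrices A n n' t U V \<and> (u11, u12) \<in> W' \<longrightarrow> (u21, u22) \<in> W"
    using assms(1) unfolding term_condition_def by blast
  with assms(2) show "\<exists>U\<in>\<U>. \<exists>V\<in>\<V>. \<exists>W'\<in>\<W>. \<forall>u11 u12 u21 u22.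
      (u11, u12, u21, u22) \<in> matrices A n n' t U V \<and> (u11, u12) \<in> W' \<longrightarrow> (u21, u22) \<in> W"
    by blast
qed

section \<open>Matrices and the term condition under homomorphisms\<close>

lemma matrices_hom:
  assumes B: "is_algebra \<Sigma> B" and h: "is_hom \<Sigma> B A h"
    and t: "wf_trm \<Sigma> t" "vars_trm t \<subseteq> {..<n + n'}"
    and m: "(u11, u12, u21, u22) \<in>
      matrices B n n' t (inverse_image_rel (carrier B) h U) (inverse_image_rel (carrier B) h V)"
  shows "(h u11, h u12, h u21, h u22) \<in> matrices A n n' t U V"
proof -
  have val: "h (trm_val B ((!) (xs @ ys)) t) = trm_val A ((!) (map h xs @ map h ys)) t"
    if "length xs = n" "length ys = n'" "set xs \<subseteq> carrier B" "set ys \<subseteq> carrier B" for xs ys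
  proof -
    have "h (trm_val B ((!) (xs @ ys)) t) = trm_val A (\<lambda>v. h ((xs @ ys) ! v)) t"
      by (rule hom_trm_val[OF B h t(1)], rule nth_image_carrier[OF _ _ t(2)]) (use that in auto)
    \<comment> \<open>Indexing commutes with \<open>map\<close> only within the length of the list;
      the bound on the variables of \<open>t\<close> keeps the indices there.\<close>
    also have "\<dots> = trm_val A ((!) (map h (xs @ ys))) t"
      by (rule trm_val_cong, subst nth_map) (use that t(2) in auto)
    finally show ?thesis by simp
  qed
  have hc: "h x \<in> carrier A" if "x \<in> carrier B" for x
    using h that by (auto simp: is_hom_def)
  show ?thesis using m
  proof (rule matricesE)
    fix a a' b c
    assume *: "u11 = trm_val B ((!) (a @ b)) t" "u12 = trm_val B ((!) (a @ c)) t"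
      "u21 = trm_val B ((!) (a' @ b)) t" "u22 = trm_val B ((!) (a' @ c)) t"
      "length a = n" "length a' = n" "length b = n'" "length c = n'"
      "set a \<subseteq> carrier B" "set a' \<subseteq> carrier B" "set b \<subseteq> carrier B" "set c \<subseteq> carrier B"
      "list_all2 (\<lambda>x y. (x, y) \<in> inverse_image_rel (carrier B) h U) a a'"
      "list_all2 (\<lambda>x y. (x, y) \<in> inverse_image_rel (carrier B) h V) b c"
    have "list_all2 (\<lambda>x y. (x, y) \<in> U) (map h a) (map h a')"
      using *(13) by (auto simp: list.rel_map inverse_image_rel_def elim!: list_all2_mono)
    moreover have "list_all2 (\<lambda>x y. (x, y) \<in> V) (map h b) (map h c)"
      using *(14) by (auto simp: list.rel_map inverse_image_rel_def elim!: list_all2_mono)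
    ultimately show ?thesis
      by (intro matricesI[of "map h a" _ "map h a'" "map h b" _ "map h c"])
        (use * in \<open>auto simp: val intro!: hc\<close>)
  qed
qed

text \<open>A matrix for the preimage relations is mapped by \<open>h\<close> to a matrix in
  \<open>A\<close>, where the given condition applies; the conclusion pulls back because the entries
  lie in the carrier of \<open>B\<close>.\<close>

lemma term_condition_inverse_image:
  fixes A :: "('f, 'a) algebra" and B :: "('f, 'b) algebra"
  assumes B: "is_algebra \<Sigma> B" and h: "is_hom \<Sigma> B A h"
    and U: "\<U> \<in> carrier (Unif \<Sigma> A)" and V: "\<V> \<in> carrier (Unif \<Sigma> A)" and W: "\<W> \<in> carrier (Unif \<Sigma> A)"
    and tc: "term_condition \<Sigma> A \<U> \<V> \<W>"
  shows "term_condition \<Sigma> B (inverse_image_unif B h \<U>) (inverse_image_unif B h \<V>) (inverse_image_unif B h \<W>)"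
  unfolding term_condition_def
proof (intro allI impI ballI)
  let ?r = "inverse_image_rel (carrier B) h"
  have base: "?r U \<in> inverse_image_unif B h \<U>" if "\<U> \<in> carrier (Unif \<Sigma> A)" "U \<in> \<U>" for U \<U>
    unfolding inverse_image_unif_eq[OF that(1)] using that(2) by (auto simp: inverse_image_rel_def)
  fix n n' :: nat and t P assume t: "wf_trm \<Sigma> t \<and> vars_trm t \<subseteq> {..<n + n'}" and P: "P \<in> inverse_image_unif B h \<W>"
  from P obtain W0 where W0: "W0 \<in> \<W>" "?r W0 \<subseteq> P" unfolding inverse_image_unif_eq[OF W] by blast
  from tc t W0(1) obtain U0 V0 W' where 0: "U0 \<in> \<U>" "V0 \<in> \<V>" "W' \<in> \<W>" "\<And>u11 u12 u21 u22.
      (u11, u12, u21, u22) \<in> matrices A n n' t U0 V0 \<and> (u11, u12) \<in> W' \<Longrightarrow> (u21, u22) \<in> W0"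
    unfolding term_condition_def by meson
  have "(u21, u22) \<in> P" if m: "(u11, u12, u21, u22) \<in> matrices B n n' t (?r U0) (?r V0)"
    and r: "(u11, u12) \<in> ?r W'" for u11 u12 u21 u22
  proof -
    have "(h u21, h u22) \<in> W0"
      by (rule 0(4)[of "h u11" "h u12"])
        (use matrices_hom[OF B h _ _ m] t r in \<open>simp add: inverse_image_rel_def\<close>)
    then have "(u21, u22) \<in> ?r W0"
      using matrices_closed[OF B _ _ m] t by (simp add: inverse_image_rel_def)
    with W0(2) show ?thesis by blast
  qed
  then show "\<exists>U\<in>inverse_image_unif B h \<U>. \<exists>V\<in>inverse_image_unif B h \<V>. \<exists>W'\<in>inverse_image_unif B h \<W>.
      \<forall>u11 u12 u21 u22. (u11, u12, u21, u22) \<in> matrices B n n' t U V \<and> (u11, u12) \<in> W' \<longrightarrow> (u21, u22) \<in> P"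
    using base[OF U 0(1)] base[OF V 0(2)] base[OF W 0(3)] by blast
qed

section \<open>Symmetry\<close>

text \<open>Uniform version of the shifting lemma: the points \<open>m\<^sub>i(c, a, b, d)\<close> form a chain from
  \<open>c\<close> to \<open>d\<close>, whose consecutive members are compared through \<open>m\<^sub>i(c, c, d, d)\<close> or through
  \<open>m\<^sub>i(c, a, a, d)\<close>.\<close>

lemma day_terms_shifting:
  assumes A: "is_algebra \<Sigma> A" and day: "day_terms \<Sigma> A N m" and W: "\<W> \<in> carrier (Unif \<Sigma> A)" and "W \<in> \<W>"
  obtains W' where "W' \<in> \<W>"
    and "\<And>a b c d. a \<in> carrier A \<Longrightarrow> b \<in> carrier A \<Longrightarrow> c \<in> carrier A \<Longrightarrow> d \<in> carrier A \<Longrightarrow> (a, b) \<in> W' \<Longrightarrow>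
      (\<And>i. i \<le> N \<Longrightarrow> (trm_val A (quad c c d d) (m i), trm_val A (quad c a b d) (m i)) \<in> W') \<Longrightarrow> (c, d) \<in> W"
proof -
  obtain W1 where W1: "W1 \<in> \<W>"
    "\<And>f. f 0 \<in> carrier A \<Longrightarrow> (\<And>i. i < N \<Longrightarrow> (f i, f (Suc i)) \<in> W1) \<Longrightarrow> (f 0, f N) \<in> W"
    using Unif_chain[OF W \<open>W \<in> \<W>\<close>, of N] by metis
  obtain W2 where W2: "W2 \<in> \<W>" "\<And>x y z. (x, y) \<in> W2 \<Longrightarrow> (x, z) \<in> W2 \<Longrightarrow> (y, z) \<in> W1"
    using Unif_half[OF W W1(1)] by blast
  have wf: "wf_trm \<Sigma> (m i)" if "i \<le> N" for i using day that by (simp add: day_terms_def)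
  have "\<exists>U\<in>\<W>. \<forall>\<rho> \<rho>'. (\<forall>v\<in>vars_trm (m i). (\<rho> v, \<rho>' v) \<in> U) \<longrightarrow>
      (trm_val A \<rho> (m i), trm_val A \<rho>' (m i)) \<in> W2" if "i \<le> N" for i
    using trm_val_uniformly_continuous[OF W wf[OF that] W2(1)] by metis
  then obtain U where U: "\<And>i. i \<le> N \<Longrightarrow> U i \<in> \<W>"
    "\<And>i \<rho> \<rho>'. i \<le> N \<Longrightarrow> (\<forall>v\<in>vars_trm (m i). (\<rho> v, \<rho>' v) \<in> U i) \<Longrightarrow>
      (trm_val A \<rho> (m i), trm_val A \<rho>' (m i)) \<in> W2"
    by metis
  \<comment> \<open>\<open>W2\<close> bounds the hypotheses on the Day terms, and the finitely many
    \<open>U i\<close> allow \<open>a\<close> to be replaced by \<open>b\<close> inside each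
    term.\<close>
  define W' where "W' = W2 \<inter> ((carrier A \<times> carrier A) \<inter> (\<Inter>i\<in>{..N}. U i))"
  show thesis
  proof (rule that)
    show "W' \<in> \<W>" unfolding W'_def by (intro Unif_Int[OF W] Unif_INT[OF W] W2(1)) (use U(1) in auto)
    fix a b c d
    assume S: "a \<in> carrier A" "b \<in> carrier A" "c \<in> carrier A" "d \<in> carrier A" and ab: "(a, b) \<in> W'"
      and row: "\<And>i. i \<le> N \<Longrightarrow> (trm_val A (quad c c d d) (m i), trm_val A (quad c a b d) (m i)) \<in> W'"
    have mid: "(trm_val A (quad c a a d) (m i), trm_val A (quad c a b d) (m i)) \<in> W2" if "i \<le> N" for i
    proof (rule U(2)[OF that], rule ballI)
      have refl: "(x, x) \<in> U i" if "x \<in> carrier A" for x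
        using Unif_refl[OF W U(1)[OF \<open>i \<le> N\<close>] that] .
      have "(a, b) \<in> U i" using ab that by (auto simp: W'_def)
      then show "(quad c a a d v, quad c a b d v) \<in> U i" for v
        using refl S by (simp add: quad_def)
    qed
    have ends: "trm_val A (quad c a b d) (m 0) = c" "trm_val A (quad c a b d) (m N) = d"
      using day S by (simp_all add: day_terms_def)
    have "(trm_val A (quad c a b d) (m i), trm_val A (quad c a b d) (m (Suc i))) \<in> W1" if "i < N" for i
    proof -
      \<comment> \<open>The value shared by \<open>m i\<close> and \<open>m (Suc i)\<close> is the
        common left point that the choice of \<open>W2\<close> requires.\<close>
      have "trm_val A (quad c c d d) (m i) = trm_val A (quad c c d d) (m (Suc i)) \<or>
          trm_val A (quad c a a d) (m i) = trm_val A (quad c a a d) (m (Suc i))"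
        using day that S unfolding day_terms_def by blast
      moreover have "(trm_val A (quad c c d d) (m j), trm_val A (quad c a b d) (m j)) \<in> W2" if "j \<le> N" for j
        using row[OF that] by (simp add: W'_def)
      ultimately show ?thesis using mid[of i] mid[of "Suc i"] that W2(2)
        by (metis Suc_leI less_imp_le)
    qed
    from W1(2)[of "\<lambda>i. trm_val A (quad c a b d) (m i)", OF _ this] show "(c, d) \<in> W"
      by (simp add: ends S)
  qed
qed

text \<open>A \<open>U\<close>-\<open>V\<close>-matrix with entries \<open>t(a, b), \<dots>\<close> yields for each Day term a \<open>V\<close>-\<open>U\<close>-matrix
  with respect to the term \<open>m\<^sub>i(t(a', b), t(a, b), t(a, c), t(a', c))\<close>, in whose first row
  \<open>c\<close> is replaced by \<open>b\<close> and in whose first column \<open>a\<close> is replaced by \<open>a'\<close>.  Its first row is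
  constant since \<open>m\<^sub>i(x, y, y, x) = x\<close>, and its second row is the pair to which the shifting lemma
  applies.\<close>

lemma term_condition_commute:
  fixes A :: "('f, 'a) algebra"
  assumes A: "is_algebra \<Sigma> A" and day: "day_terms \<Sigma> A N m"
    and \<U>: "\<U> \<in> carrier (Unif \<Sigma> A)" and \<V>: "\<V> \<in> carrier (Unif \<Sigma> A)" and \<W>: "\<W> \<in> carrier (Unif \<Sigma> A)"
    and tc: "term_condition \<Sigma> A \<V> \<U> \<W>"
  shows "term_condition \<Sigma> A \<U> \<V> \<W>"
  unfolding term_condition_def
proof (intro allI impI ballI)
  fix n n' :: nat and t :: "('f, nat) trm" and W
  assume "wf_trm \<Sigma> t \<and> vars_trm t \<subseteq> {..<n + n'}" and W: "W \<in> \<W>"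
  then have t: "wf_trm \<Sigma> t" "vars_trm t \<subseteq> {..<n + n'}" by blast+
  \<comment> \<open>\<open>W0\<close> serves twice: as the closeness demanded of the first row, and
    as the target of the term condition for the terms built from \<open>m i\<close>.\<close>
  obtain W0 where W0: "W0 \<in> \<W>"
    and shift: "\<And>a b c d. a \<in> carrier A \<Longrightarrow> b \<in> carrier A \<Longrightarrow> c \<in> carrier A \<Longrightarrow> d \<in> carrier A \<Longrightarrow> (a, b) \<in> W0 \<Longrightarrow>
      (\<And>i. i \<le> N \<Longrightarrow> (trm_val A (quad c c d d) (m i), trm_val A (quad c a b d) (m i)) \<in> W0) \<Longrightarrow> (c, d) \<in> W"
    using day_terms_shifting[OF A day \<W> W] by metis
  define q :: "nat \<Rightarrow> nat \<Rightarrow> ('f, nat) trm" where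
    "q j k = subst (\<lambda>v. Var (if v < n then j + v else k + (v - n))) t" for j k
  \<comment> \<open>The variables form consecutive blocks of lengths \<open>n'\<close>,
    \<open>n'\<close>, \<open>n\<close>, \<open>n\<close>, starting at \<open>0\<close>,
    \<open>n'\<close>, \<open>2 * n'\<close> and \<open>2 * n' + n\<close>. The first two hold
    arguments for the second block of \<open>t\<close> and together form the
    \<open>\<V>\<close>-block; the other two hold arguments for its first block and form the
    \<open>\<U>\<close>-block.\<close>
  define p where "p i = subst (quad (q (2 * n') 0) (q (2 * n' + n) 0) (q (2 * n' + n) n') (q (2 * n') n')) (m i)" for i
  have q_vars: "vars_trm (q j k) \<subseteq> {..<2 * n' + 2 * n}" if "j \<le> 2 * n' + n" "k \<le> n'" for j k
    using that t(2) by (fastforce simp: q_def vars_trm_subst subset_iff)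
  have p: "wf_trm \<Sigma> (p i) \<and> vars_trm (p i) \<subseteq> {..<2 * n' + 2 * n}" if "i \<le> N" for i
  proof
    have "wf_trm \<Sigma> (q j k)" for j k unfolding q_def by (rule wf_trm_subst[OF t(1)]) simp
    then show "wf_trm \<Sigma> (p i)"
      unfolding p_def by (intro wf_trm_subst) (use day that in \<open>auto simp: day_terms_def quad_def\<close>)
    show "vars_trm (p i) \<subseteq> {..<2 * n' + 2 * n}"
      unfolding p_def vars_trm_subst by (rule UN_least) (simp add: quad_def q_vars)
  qed
  define T where "T z x = trm_val A ((!) (z @ x)) t" for z x
  have q_val: "trm_val A ((!) L) (q j k) = T z x"
    if "length z = n" "length x = n'" "\<And>v. v < n \<Longrightarrow> L ! (j + v) = z ! v" "\<And>v. v < n' \<Longrightarrow> L ! (k + v) = x ! v"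
    for L j k z x
    unfolding q_def trm_val_subst T_def
  proof (rule trm_val_cong)
    fix v assume "v \<in> vars_trm t"
    then have "v < n + n'" using t(2) by blast
    then show "trm_val A ((!) L) (Var (if v < n then j + v else k + (v - n))) = (z @ x) ! v"
      using that(1,2) that(3)[of v] that(4)[of "v - n"] by (auto simp: nth_append)
  qed
  have p_val: "trm_val A ((!) (x @ y @ z @ w)) (p i) = trm_val A (quad (T z x) (T w x) (T w y) (T z y)) (m i)"
    if l: "length x = n'" "length y = n'" "length z = n" "length w = n" for x y z w i
  proof -
    let ?L = "x @ y @ z @ w"
    have "trm_val A ((!) ?L) (q (2 * n') 0) = T z x" "trm_val A ((!) ?L) (q (2 * n' + n) 0) = T w x"
      "trm_val A ((!) ?L) (q (2 * n' + n) n') = T w y" "trm_val A ((!) ?L) (q (2 * n') n') = T z y"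
      by (rule q_val; simp add: l nth_append)+
    then show ?thesis
      unfolding p_def trm_val_subst by (intro trm_val_cong) (simp add: quad_def)
  qed
  have "\<exists>V\<in>\<V>. \<exists>U\<in>\<U>. \<exists>W'\<in>\<W>. \<forall>u11 u12 u21 u22.
      (u11, u12, u21, u22) \<in> matrices A (2 * n') (2 * n) (p i) V U \<and> (u11, u12) \<in> W' \<longrightarrow> (u21, u22) \<in> W0"
    if "i \<le> N" for i
    using tc p[OF that] W0 unfolding term_condition_def by blast
  then obtain V U W' where VUW: "\<And>i. i \<le> N \<Longrightarrow> V i \<in> \<V>" "\<And>i. i \<le> N \<Longrightarrow> U i \<in> \<U>" "\<And>i. i \<le> N \<Longrightarrow> W' i \<in> \<W>"
    "\<And>i u11 u12 u21 u22. i \<le> N \<Longrightarrow> (u11, u12, u21, u22) \<in> matrices A (2 * n') (2 * n) (p i) (V i) (U i) \<Longrightarrow>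
      (u11, u12) \<in> W' i \<Longrightarrow> (u21, u22) \<in> W0"
    by metis
  \<comment> \<open>The new matrices pass from \<open>a'\<close> to \<open>a\<close>, against the
    direction of the given pairs; hence the converses.\<close>
  define U0 where "U0 = (carrier A \<times> carrier A) \<inter> (\<Inter>i\<in>{..N}. (U i)\<inverse>)"
  define V0 where "V0 = (carrier A \<times> carrier A) \<inter> (\<Inter>i\<in>{..N}. V i)"
  have U0: "U0 \<in> \<U>" unfolding U0_def by (rule Unif_INT[OF \<U>]) (auto intro: Unif_converse[OF \<U>] VUW)
  have V0: "V0 \<in> \<V>" unfolding V0_def by (rule Unif_INT[OF \<V>]) (auto intro: VUW)
  have "(u21, u22) \<in> W" if mat: "(u11, u12, u21, u22) \<in> matrices A n n' t U0 V0" and "(u11, u12) \<in> W0"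
    for u11 u12 u21 u22
  proof (rule shift[of u11 u12])
    note u = matrices_closed[OF A t mat]
    show "u11 \<in> carrier A" "u12 \<in> carrier A" "u21 \<in> carrier A" "u22 \<in> carrier A" by (fact u)+
    show "(u11, u12) \<in> W0" by fact
    fix i assume i: "i \<le> N"
    from mat show "(trm_val A (quad u21 u21 u22 u22) (m i), trm_val A (quad u21 u11 u12 u22) (m i)) \<in> W0"
    proof (rule matricesE)
      fix a a' b c
      assume *: "u11 = trm_val A ((!) (a @ b)) t" "u12 = trm_val A ((!) (a @ c)) t"
        "u21 = trm_val A ((!) (a' @ b)) t" "u22 = trm_val A ((!) (a' @ c)) t"
        and l: "length a = n" "length a' = n" "length b = n'" "length c = n'"
        and S: "set a \<subseteq> carrier A" "set a' \<subseteq> carrier A" "set b \<subseteq> carrier A" "set c \<subseteq> carrier A"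
        and r: "list_all2 (\<lambda>x y. (x, y) \<in> U0) a a'" "list_all2 (\<lambda>x y. (x, y) \<in> V0) b c"
      have Ui: "list_all2 (\<lambda>x y. (x, y) \<in> U i) a' a"
        using r(1) i by (auto simp: list_all2_conv_all_nth U0_def)
      have Vi: "list_all2 (\<lambda>x y. (x, y) \<in> V i) b c"
        using r(2) i by (auto simp: list_all2_conv_all_nth V0_def)
      have D2: "trm_val A (quad x y y x) (m i) = x" if "x \<in> carrier A" "y \<in> carrier A" for x y
        using day i that by (simp add: day_terms_def)
      \<comment> \<open>The leading blocks \<open>b\<close> and \<open>a'\<close> stay fixed to keep
        the outer arguments of \<open>m i\<close> apart from those that vary. The first row consists
        of \<open>m\<^sub>i(u21, u21, u21, u21)\<close> and
        \<open>m\<^sub>i(u21, u11, u11, u21)\<close>, both equal to \<open>u21\<close>.\<close>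
      have "(u21, u21, trm_val A (quad u21 u21 u22 u22) (m i), trm_val A (quad u21 u11 u12 u22) (m i))
          \<in> matrices A (2 * n') (2 * n) (p i) (V i) (U i)"
        by (rule matricesI[of "b @ b" _ "b @ c" "a' @ a'" _ "a' @ a"])
          (use l S Ui Vi D2 u in \<open>simp_all add: p_val T_def *[symmetric] list_all2_appendI
            list_all2_refl_carrier[OF \<U> VUW(2)[OF i]] list_all2_refl_carrier[OF \<V> VUW(1)[OF i]]\<close>)
      then show ?thesis
        \<comment> \<open>The constant first row lies in \<open>W' i\<close> by reflexivity.\<close>
        by (rule VUW(4)[OF i]) (rule Unif_refl[OF \<W> VUW(3)[OF i] u(3)])
    qed
  qed
  then show "\<exists>U\<in>\<U>. \<exists>V\<in>\<V>. \<exists>W'\<in>\<W>. \<forall>u11 u12 u21 u22.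
      (u11, u12, u21, u22) \<in> matrices A n n' t U V \<and> (u11, u12) \<in> W' \<longrightarrow> (u21, u22) \<in> W"
    using U0 V0 W0 by blast
qed

section \<open>Properties of the commutator\<close>

lemma commutator_closed:
  assumes "is_algebra \<Sigma> A" "\<U> \<in> carrier (Unif \<Sigma> A)" "\<V> \<in> carrier (Unif \<Sigma> A)"
  shows "commutator \<Sigma> A \<U> \<V> \<in> carrier (Unif \<Sigma> A)"
    and "term_condition \<Sigma> A \<U> \<V> (commutator \<Sigma> A \<U> \<V>)"
  using least_commutator[OF assms] by (auto simp: least_def)

lemma commutator_le:
  assumes "is_algebra \<Sigma> A" "\<U> \<in> carrier (Unif \<Sigma> A)" "\<V> \<in> carrier (Unif \<Sigma> A)"
    and "\<W> \<in> carrier (Unif \<Sigma> A)" "term_condition \<Sigma> A \<U> \<V> \<W>"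
  shows "commutator \<Sigma> A \<U> \<V> \<sqsubseteq>\<^bsub>Unif \<Sigma> A\<^esub> \<W>"
  using least_commutator[OF assms(1-3)] assms(4,5) by (auto simp: least_def)

theorem theorem7p1:
  fixes \<Sigma> :: "'f signature" and E :: "'f identities"
    and A :: "('f, 'a) algebra" and B :: "('f, 'b) algebra"
  assumes "wf_identities \<Sigma> E" and "congruence_modular \<Sigma> E" and "in_variety \<Sigma> E A"
  shows
    "(\<forall>\<U>\<in>carrier (Unif \<Sigma> A). \<forall>\<V>\<in>carrier (Unif \<Sigma> A).
        commutator \<Sigma> A \<U> \<V> = commutator \<Sigma> A \<V> \<U>)
   \<and> (\<forall>\<U>\<in>carrier (Unif \<Sigma> A). \<forall>\<U>'\<in>carrier (Unif \<Sigma> A). \<forall>\<V>\<in>carrier (Unif \<Sigma> A).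
        \<U> \<sqsubseteq>\<^bsub>Unif \<Sigma> A\<^esub> \<U>' \<longrightarrow> commutator \<Sigma> A \<U> \<V> \<sqsubseteq>\<^bsub>Unif \<Sigma> A\<^esub> commutator \<Sigma> A \<U>' \<V>)
   \<and> (\<forall>\<U>\<in>carrier (Unif \<Sigma> A). \<forall>\<V>\<in>carrier (Unif \<Sigma> A).
        commutator \<Sigma> A \<U> \<V> \<sqsubseteq>\<^bsub>Unif \<Sigma> A\<^esub> \<U> \<sqinter>\<^bsub>Unif \<Sigma> A\<^esub> \<V>)
   \<and> (\<forall>f. in_variety \<Sigma> E B \<and> is_hom \<Sigma> B A f \<longrightarrow>
        (\<forall>\<U>\<in>carrier (Unif \<Sigma> A). \<forall>\<V>\<in>carrier (Unif \<Sigma> A).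
          commutator \<Sigma> B (inverse_image_unif B f \<U>) (inverse_image_unif B f \<V>)
            \<sqsubseteq>\<^bsub>Unif \<Sigma> B\<^esub> inverse_image_unif B f (commutator \<Sigma> A \<U> \<V>)))"
proof (intro conjI ballI allI impI; (elim conjE)?)
  have A: "is_algebra \<Sigma> A" using assms(3) by (simp add: in_variety_def)
  obtain N m where day: "day_terms \<Sigma> A N m" by (rule day_terms_exist[OF assms])
  fix \<U> \<V> assume U: "\<U> \<in> carrier (Unif \<Sigma> A)" and V: "\<V> \<in> carrier (Unif \<Sigma> A)"
  \<comment> \<open>Exchanging the roles of \<open>\<U>\<close> and \<open>\<V>\<close> gives the
    reverse inclusion, so both commutators are least elements of one set.\<close>
  have "{\<W> \<in> carrier (Unif \<Sigma> A). term_condition \<Sigma> A \<U> \<V> \<W>} =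
      {\<W> \<in> carrier (Unif \<Sigma> A). term_condition \<Sigma> A \<V> \<U> \<W>}"
    using term_condition_commute[OF A day U V] term_condition_commute[OF A day V U] by blast
  then show "commutator \<Sigma> A \<U> \<V> = commutator \<Sigma> A \<V> \<U>"
    unfolding commutator_def by simp
  show "commutator \<Sigma> A \<U> \<V> \<sqsubseteq>\<^bsub>Unif \<Sigma> A\<^esub> commutator \<Sigma> A \<U>' \<V>"
    if "\<U>' \<in> carrier (Unif \<Sigma> A)" "\<U> \<sqsubseteq>\<^bsub>Unif \<Sigma> A\<^esub> \<U>'" for \<U>'
    using that commutator_closed[OF A that(1) V]
    by (intro commutator_le[OF A U V]) (auto simp: Unif_le intro: term_condition_antimono)
  \<comment> \<open>Both \<open>\<U>\<close> and \<open>\<V>\<close> are among the uniformities of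
    which the commutator is the least.\<close>
  have "commutator \<Sigma> A \<U> \<V> \<in> Lower (Unif \<Sigma> A) {\<U>, \<V>}"
    using commutator_closed[OF A U V] commutator_le[OF A U V] U V
      term_condition_left[OF U V] term_condition_right[OF U V] by (auto simp: Lower_def)
  then show "commutator \<Sigma> A \<U> \<V> \<sqsubseteq>\<^bsub>Unif \<Sigma> A\<^esub> \<U> \<sqinter>\<^bsub>Unif \<Sigma> A\<^esub> \<V>"
    using greatest_meet_Unif[OF U V] by (simp add: greatest_def)
  fix f assume "in_variety \<Sigma> E B" and f: "is_hom \<Sigma> B A f"
  then have B: "is_algebra \<Sigma> B" by (simp add: in_variety_def)
  note C = commutator_closed[OF A U V]
  show "commutator \<Sigma> B (inverse_image_unif B f \<U>) (inverse_image_unif B f \<V>)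
      \<sqsubseteq>\<^bsub>Unif \<Sigma> B\<^esub> inverse_image_unif B f (commutator \<Sigma> A \<U> \<V>)"
    \<comment> \<open>The inverse image of the commutator satisfies the term condition in
      \<open>B\<close>, so it lies above the least solution there.\<close>
    by (intro commutator_le[OF B] inverse_image_unif_closed[OF _ B f]
        term_condition_inverse_image[OF B f U V C] U V C(1))
qed

end
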